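(* Let $X$ be a complex Banach space, let $T(\cdot)=(T(t))_{t\ge 0}$ and $T_n(\cdot)=(T_n(t))_{t\ge 0}$, $n\in\mathbb{N}$, be $C_0$-semigroups on $X$ with generators $A$ and $A_n$, $n\in\mathbb{N}$, respectively. Assume that for some constants $M\geq 1$, $\omega\in\mathbb{R}$ the estimates $\|T(t)\|\leq Me^{\omega t}$ and $\|T_n(t)\|\leq Me^{\omega t}$ hold for all $t\geq 0$ and $n\in\mathbb{N}$. Let further $D$ be a core for $A$. Consider the following assertions. (a) $D\subset D(A_n)$ for every $n\in\mathbb{N}$ and $\lim_{n\to\infty}A_n x=Ax$ weakly for all $x\in D$. (b) For every $x\in D$ there exist $x_n\in D(A_n)$, $n\in\mathbb{N}$, such that $\lim_{n\to\infty}x_n=x$ weakly and $\lim_{n\to\infty}A_n x_n=Ax$ weakly. (c) There is some $\lambda\in\mathbb{C}$ with $\operatorname{Re}\lambda>\omega$ such that $\lim_{n\to\infty}R(\lambda, A_n)x=R(\lambda, A)x$ weakly for every $x\in X$. (d) $\lim_{n\to\infty}T_n(t)x=T(t)x$ weakly for every $x\in X$, uniformly in $t$ on compact intervals. Then (d) $\Rightarrow$ (c), (c) $\Rightarrow$ (b), and (a) $\Rightarrow$ (b). On the other hand, none of the conditions (a), (b), (c) implies (d) in general, even if all operators $A_n$ are bounded; that is, for each of the conditions (a), (b) and (c) there exist $X$, $T(\cdot)$, $T_n(\cdot)$ ($n\in\mathbb{N}$), $M$, $\omega$ and $D$ satisfying all the assumptions above, with every $A_n$ a bounded operator on $X$,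 such that this condition holds but (d) fails.
   Context: $D(B)$ denotes the domain of an operator $B$. A core for $A$ is a linear subspace $D\subset D(A)$ that is dense in $D(A)$ for the graph norm $\|x\|+\|Ax\|$. For $\lambda$ in the resolvent set of $B$, $R(\lambda,B):=(\lambda I-B)^{-1}$ is the resolvent. Weak convergence of a sequence in $X$ means convergence in the weak topology $\sigma(X,X')$, where $X'$ is the dual space of $X$. In (d), weak convergence uniformly in $t$ on compact intervals means: for every $x\in X$, every $x'\in X'$ and every $t_0>0$, $\sup_{t\in[0,t_0]}|\langle T_n(t)x-T(t)x,x'\rangle|\to 0$ as $n\to\infty$. *)

theory Defs
  imports "HOL-Analysis.Analysis" "HOL-Algebra.Module"
begin

text \<open>
  A Banach space is a carrier-based structure, because the counterexample part of the theorem
  quantifies existentially over the space. The fields \<open>mult\<close> and \<open>one\<close> inherited from the module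
  record are ignored.
\<close>

definition complex_field :: "complex ring" where
  "complex_field = \<lparr>carrier = UNIV, mult = (*), one = 1, zero = 0, add = (+)\<rparr>"

record 'a normed_module = "(complex, 'a) module" +
  vnorm :: "'a \<Rightarrow> real"

text \<open>
  The value off the carrier is chosen because \<^locale>\<open>Metric_space\<close> requires a distance to be
  nonnegative and symmetric on the whole type, not only on the carrier.
\<close>
definition vdist :: "'a normed_module \<Rightarrow> 'a \<Rightarrow> 'a \<Rightarrow> real" where
  "vdist X x y = (if x \<in> carrier X \<and> y \<in> carrier X then vnorm X (x \<ominus>\<^bsub>X\<^esub> y) else 0)"

locale complex_normed_space = Module.module complex_field X
  for X :: "'a normed_module" (structure) +
  assumes vnorm_nonneg: "x \<in> carrier X \<Longrightarrow> 0 \<le> vnorm X x"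
    and vnorm_eq_zero: "x \<in> carrier X \<Longrightarrow> vnorm X x = 0 \<longleftrightarrow> x = \<zero>\<^bsub>X\<^esub>"
    and vnorm_triangle: "x \<in> carrier X \<Longrightarrow> y \<in> carrier X \<Longrightarrow>
      vnorm X (x \<oplus>\<^bsub>X\<^esub> y) \<le> vnorm X x + vnorm X y"
    and vnorm_smult: "x \<in> carrier X \<Longrightarrow> vnorm X (c \<odot>\<^bsub>X\<^esub> x) = cmod c * vnorm X x"

locale complex_banach_space = complex_normed_space +
  assumes complete: "Metric_space.mcomplete (carrier X) (vdist X)"

definition norm_topology :: "'a normed_module \<Rightarrow> 'a topology" where
  "norm_topology X = Metric_space.mtopology (carrier X) (vdist X)"

definition dual_space :: "'a normed_module \<Rightarrow> ('a \<Rightarrow> complex) set" where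
  "dual_space X = {\<phi>.
     (\<forall>x\<in>carrier X. \<forall>y\<in>carrier X. \<phi> (x \<oplus>\<^bsub>X\<^esub> y) = \<phi> x + \<phi> y) \<and>
     (\<forall>c. \<forall>x\<in>carrier X. \<phi> (c \<odot>\<^bsub>X\<^esub> x) = c * \<phi> x) \<and>
     (\<exists>C. \<forall>x\<in>carrier X. cmod (\<phi> x) \<le> C * vnorm X x)}"

definition weak_topology :: "'a normed_module \<Rightarrow> 'a topology" where
  "weak_topology X =
     topology_generated_by {{x \<in> carrier X. \<phi> x \<in> U} |\<phi> U. \<phi> \<in> dual_space X \<and> open U}"

definition weakly_converges :: "'a normed_module \<Rightarrow> (nat \<Rightarrow> 'a) \<Rightarrow> 'a \<Rightarrow> bool" where
  "weakly_converges X xs x \<longleftrightarrow> limitin (weak_topology X) xs x sequentially"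

definition bounded_operator :: "'a normed_module \<Rightarrow> ('a \<Rightarrow> 'a) \<Rightarrow> bool" where
  "bounded_operator X B \<longleftrightarrow>
     B \<in> carrier X \<rightarrow> carrier X \<and>
     (\<forall>x\<in>carrier X. \<forall>y\<in>carrier X. B (x \<oplus>\<^bsub>X\<^esub> y) = B x \<oplus>\<^bsub>X\<^esub> B y) \<and>
     (\<forall>c. \<forall>x\<in>carrier X. B (c \<odot>\<^bsub>X\<^esub> x) = c \<odot>\<^bsub>X\<^esub> B x) \<and>
     (\<exists>C. \<forall>x\<in>carrier X. vnorm X (B x) \<le> C * vnorm X x)"

text \<open>
  As for \<^const>\<open>onorm\<close>, the vector \<open>x = 0\<close> contributes \<open>0 / 0 = 0\<close>; this is the operator norm
  only for operators satisfying \<^const>\<open>bounded_operator\<close>.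
\<close>
definition operator_norm :: "'a normed_module \<Rightarrow> ('a \<Rightarrow> 'a) \<Rightarrow> real" where
  "operator_norm X B = (SUP x\<in>carrier X. vnorm X (B x) / vnorm X x)"

text \<open>
  A not everywhere defined operator is a pair of its domain and a function whose values outside
  the domain are irrelevant.
\<close>
type_synonym 'a operator = "'a set \<times> ('a \<Rightarrow> 'a)"

abbreviation opdom :: "'a operator \<Rightarrow> 'a set" where "opdom \<equiv> fst"
abbreviation opfun :: "'a operator \<Rightarrow> 'a \<Rightarrow> 'a" where "opfun \<equiv> snd"

definition everywhere_bounded :: "'a normed_module \<Rightarrow> 'a operator \<Rightarrow> bool" where
  "everywhere_bounded X B \<longleftrightarrow> opdom B = carrier X \<and> bounded_operator X (opfun B)"

text \<open>The values of a semigroup at negative times are irrelevant.\<close>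
definition C0_semigroup :: "'a normed_module \<Rightarrow> (real \<Rightarrow> 'a \<Rightarrow> 'a) \<Rightarrow> bool" where
  "C0_semigroup X T \<longleftrightarrow>
     (\<forall>t\<ge>0. bounded_operator X (T t)) \<and>
     (\<forall>x\<in>carrier X. T 0 x = x) \<and>
     (\<forall>s\<ge>0. \<forall>t\<ge>0. \<forall>x\<in>carrier X. T (s + t) x = T s (T t x)) \<and>
     (\<forall>x\<in>carrier X. continuous_map (top_of_set {0..}) (norm_topology X) (\<lambda>t. T t x))"

definition generates_at ::
    "'a normed_module \<Rightarrow> (real \<Rightarrow> 'a \<Rightarrow> 'a) \<Rightarrow> 'a \<Rightarrow> 'a \<Rightarrow> bool" where
  "generates_at X T x y \<longleftrightarrow>
     limitin (norm_topology X)
       (\<lambda>t. complex_of_real (1 / t) \<odot>\<^bsub>X\<^esub> (T t x \<ominus>\<^bsub>X\<^esub> x)) y (at_right 0)"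

definition generator :: "'a normed_module \<Rightarrow> (real \<Rightarrow> 'a \<Rightarrow> 'a) \<Rightarrow> 'a operator" where
  "generator X T =
     ({x \<in> carrier X. \<exists>y. generates_at X T x y}, \<lambda>x. THE y. generates_at X T x y)"

definition graph_norm :: "'a normed_module \<Rightarrow> 'a operator \<Rightarrow> 'a \<Rightarrow> real" where
  "graph_norm X A x = vnorm X x + vnorm X (opfun A x)"

definition core_for :: "'a normed_module \<Rightarrow> 'a set \<Rightarrow> 'a operator \<Rightarrow> bool" where
  "core_for X D A \<longleftrightarrow>
     submodule D complex_field X \<and> D \<subseteq> opdom A \<and>
     (\<forall>x\<in>opdom A. \<forall>\<epsilon>>0. \<exists>y\<in>D. graph_norm X A (x \<ominus>\<^bsub>X\<^esub> y) < \<epsilon>)"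

definition resolvent :: "'a normed_module \<Rightarrow> complex \<Rightarrow> 'a operator \<Rightarrow> 'a \<Rightarrow> 'a" where
  "resolvent X z B = the_inv_into (opdom B) (\<lambda>x. z \<odot>\<^bsub>X\<^esub> x \<ominus>\<^bsub>X\<^esub> opfun B x)"

definition resolvent_set :: "'a normed_module \<Rightarrow> 'a operator \<Rightarrow> complex set" where
  "resolvent_set X B =
     {z. bij_betw (\<lambda>x. z \<odot>\<^bsub>X\<^esub> x \<ominus>\<^bsub>X\<^esub> opfun B x) (opdom B) (carrier X) \<and>
         bounded_operator X (resolvent X z B)}"

definition standing_assumptions ::
    "'a normed_module \<Rightarrow> (real \<Rightarrow> 'a \<Rightarrow> 'a) \<Rightarrow> (nat \<Rightarrow> real \<Rightarrow> 'a \<Rightarrow> 'a) \<Rightarrow>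
     real \<Rightarrow> real \<Rightarrow> 'a set \<Rightarrow> bool" where
  "standing_assumptions X T Tn M \<omega> D \<longleftrightarrow>
     complex_banach_space X \<and>
     C0_semigroup X T \<and> (\<forall>n. C0_semigroup X (Tn n)) \<and>
     M \<ge> 1 \<and>
     (\<forall>t\<ge>0. operator_norm X (T t) \<le> M * exp (\<omega> * t)) \<and>
     (\<forall>n. \<forall>t\<ge>0. operator_norm X (Tn n t) \<le> M * exp (\<omega> * t)) \<and>
     core_for X D (generator X T)"

definition core_weak_convergence ::
    "'a normed_module \<Rightarrow> 'a operator \<Rightarrow> (nat \<Rightarrow> 'a operator) \<Rightarrow> 'a set \<Rightarrow> bool" where
  "core_weak_convergence X A An D \<longleftrightarrow>
     (\<forall>n. D \<subseteq> opdom (An n)) \<and>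
     (\<forall>x\<in>D. weakly_converges X (\<lambda>n. opfun (An n) x) (opfun A x))"

definition graph_weak_convergence ::
    "'a normed_module \<Rightarrow> 'a operator \<Rightarrow> (nat \<Rightarrow> 'a operator) \<Rightarrow> 'a set \<Rightarrow> bool" where
  "graph_weak_convergence X A An D \<longleftrightarrow>
     (\<forall>x\<in>D. \<exists>xs. (\<forall>n. xs n \<in> opdom (An n)) \<and>
        weakly_converges X xs x \<and>
        weakly_converges X (\<lambda>n. opfun (An n) (xs n)) (opfun A x))"

text \<open>
  Under the growth bounds every \<open>z\<close> with real part larger than \<open>\<omega>\<close> lies in all the resolvent sets;
  the membership is stated because \<^const>\<open>resolvent\<close> is meaningful only there.
\<close>
definition resolvent_weak_convergence ::
    "'a normed_module \<Rightarrow> 'a operator \<Rightarrow> (nat \<Rightarrow> 'a operator) \<Rightarrow> real \<Rightarrow> bool" where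
  "resolvent_weak_convergence X A An \<omega> \<longleftrightarrow>
     (\<exists>z. Re z > \<omega> \<and> z \<in> resolvent_set X A \<and> (\<forall>n. z \<in> resolvent_set X (An n)) \<and>
        (\<forall>x\<in>carrier X. weakly_converges X (\<lambda>n. resolvent X z (An n) x) (resolvent X z A x)))"

text \<open>
  The growth bounds make the set under the supremum bounded.
\<close>
definition semigroup_weak_convergence ::
    "'a normed_module \<Rightarrow> (real \<Rightarrow> 'a \<Rightarrow> 'a) \<Rightarrow> (nat \<Rightarrow> real \<Rightarrow> 'a \<Rightarrow> 'a) \<Rightarrow> bool" where
  "semigroup_weak_convergence X T Tn \<longleftrightarrow>
     (\<forall>x\<in>carrier X. \<forall>\<phi>\<in>dual_space X. \<forall>t0>0.
        (\<lambda>n. SUP t\<in>{0..t0}. cmod (\<phi> (Tn n t x \<ominus>\<^bsub>X\<^esub> T t x))) \<longlonglongrightarrow> 0)"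

end

theory Submission
  imports Defs "HOL-Real_Asymp.Real_Asymp"
begin

text \<open>
  For \<open>Re z > \<omega>\<close> the resolvent is the Laplace transform \<open>R(z, A) x = \<integral> e\<^bsup>-zt\<^esup> T(t) x dt\<close>. It is obtained
  here as the limit of the Riemann sums of step \<open>2\<^sup>-\<^sup>n\<close> over \<open>[0, n]\<close>; a geometric series bounds these sums
  uniformly in the step, so that (d) \<open>\<Longrightarrow>\<close> (c) follows by comparing the sums under a functional, and
  no integration theory is needed. For (c) \<open>\<Longrightarrow>\<close> (b) take \<open>x\<^sub>n = R(z, A\<^sub>n) (z x - A x)\<close>.

  All three counterexamples come from the involutions \<open>U\<^sub>n\<close> of \<open>c\<^sub>0\<close> that exchange the coordinates
  \<open>k\<close> and \<open>k + n\<close> for \<open>k < n\<close>. They tend weakly to \<open>0\<close>, but \<open>U\<^sub>n\<^sup>2 = I\<close>, hence the semigroups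
  \<open>exp (t U\<^sub>n) = cosh t + sinh t U\<^sub>n\<close> tend weakly to \<open>cosh t\<close>, which is not a semigroup. Compare them
  with \<open>T(t) = I\<close> for (a) and (b), and with \<open>T(t) = e\<^bsup>t/2\<^esup>\<close> for (c).
\<close>

section \<open>Normed spaces with carrier\<close>

text \<open>Multiplying \<open>T(t)\<close> by \<open>exp (- z * t)\<close> shifts the generator to
  \<open>A - z\<close> and makes the semigroup decay, so it suffices to invert the generator of a
  decaying semigroup \<open>S\<close>, that is, to build one integral \<open>lap x\<close> of its
  orbit. The semigroup law does the work that uniform continuity does for an ordinary Riemann
  integral. A block of consecutive fine terms is a single coarse term applied to the average of the
  orbit over one coarse step. Refining the mesh therefore costs at most the uniform norm bound times
  the distance of that average from \<open>x\<close>, which continuity of the orbit at time 0 makes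
  small. Splitting one sum at two different times gives the shift identity
  \<open>S h (lap x) + (integral over [0, h]) = lap x\<close> in approximate form, hence
  \<open>A (lap x) = - x\<close>; that \<open>lap\<close> commutes with \<open>S\<close> then gives
  the other half of the inverse. In the counterexamples \<open>c\<^sub>0\<close> is convenient
  because permuting coordinates keeps the supremum norm, while a functional puts vanishing weight on
  far coordinates: a block pushed to infinity disappears weakly without shrinking.\<close>

lemma carrier_complex_field [simp]: "carrier complex_field = UNIV"
  and add_complex_field [simp]: "x \<oplus>\<^bsub>complex_field\<^esub> y = x + y"
  and mult_complex_field [simp]: "x \<otimes>\<^bsub>complex_field\<^esub> y = x * y"
  and zero_complex_field [simp]: "\<zero>\<^bsub>complex_field\<^esub> = 0"
  and one_complex_field [simp]: "\<one>\<^bsub>complex_field\<^esub> = 1"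
  by (simp_all add: complex_field_def)

lemma cring_complex_field: "cring complex_field"
proof (rule cringI)
  show "abelian_group complex_field"
  proof (rule abelian_groupI)
    show "\<exists>y\<in>carrier complex_field. y \<oplus>\<^bsub>complex_field\<^esub> x = \<zero>\<^bsub>complex_field\<^esub>" for x
      by (rule bexI[of _ "- x"]) auto
  qed (auto simp: add.assoc add.commute)
  show "comm_monoid complex_field"
    by (rule comm_monoidI) auto
qed (auto simp: ring_distribs)

lemma a_inv_complex_field [simp]: "\<ominus>\<^bsub>complex_field\<^esub> x = - x"
proof -
  interpret cring complex_field
    by (rule cring_complex_field)
  show ?thesis
    by (rule minus_equality) auto
qed

section \<open>Vector arithmetic and the metric of the norm\<close>

context complex_normed_space
begin

lemmas vsmult_closed [simp, intro] = smult_closed[simplified]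
lemmas vsmult_l_distr = smult_l_distr[simplified]
lemmas vsmult_r_distr = smult_r_distr[simplified]
lemmas vsmult_assoc = smult_assoc1[simplified]
lemmas vsmult_one [simp] = smult_one[simplified]
lemmas vsmult_l_null [simp] = smult_l_null[simplified]
lemmas vsmult_r_null [simp] = smult_r_null[simplified]
lemmas vsmult_l_minus = smult_l_minus[simplified]
lemmas vsmult_r_minus = smult_r_minus[simplified]

lemma vminus_closed [simp, intro]: "x \<in> carrier X \<Longrightarrow> y \<in> carrier X \<Longrightarrow> x \<ominus> y \<in> carrier X"
  by (rule M.minus_closed)

lemma vsmult_r_minus_distr:
  "x \<in> carrier X \<Longrightarrow> y \<in> carrier X \<Longrightarrow> c \<odot> (x \<ominus> y) = c \<odot> x \<ominus> c \<odot> y"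
  by (simp add: M.minus_eq vsmult_r_distr vsmult_r_minus)

lemma vsmult_l_minus_distr: "x \<in> carrier X \<Longrightarrow> (a - b) \<odot> x = a \<odot> x \<ominus> b \<odot> x"
  using vsmult_l_distr[of x a "- b"] by (simp add: M.minus_eq vsmult_l_minus)

lemma vminus_eq_smult: "x \<in> carrier X \<Longrightarrow> \<ominus> x = (- 1) \<odot> x"
  by (simp add: vsmult_l_minus)

lemma vnorm_zero [simp]: "vnorm X \<zero> = 0"
  by (simp add: vnorm_eq_zero)

lemma vnorm_minus: "x \<in> carrier X \<Longrightarrow> vnorm X (\<ominus> x) = vnorm X x"
  by (simp add: vminus_eq_smult vnorm_smult)

lemma vminus_zero [simp]: "\<ominus> \<zero> = \<zero>"
  using M.minus_equality by auto

lemma vminus_self [simp]: "x \<in> carrier X \<Longrightarrow> x \<ominus> x = \<zero>"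
  by (simp add: M.minus_eq M.r_neg)

lemma vminus_add_cancel [simp]: "x \<in> carrier X \<Longrightarrow> y \<in> carrier X \<Longrightarrow> x \<ominus> y \<oplus> y = x"
  by (simp add: M.minus_eq M.a_assoc M.l_neg)

lemma vminus_add_vminus:
  assumes "x \<in> carrier X" "y \<in> carrier X" "z \<in> carrier X"
  shows "(x \<ominus> y) \<oplus> (y \<ominus> z) = x \<ominus> z"
proof -
  have "(x \<ominus> y) \<oplus> (y \<ominus> z) = x \<oplus> ((\<ominus> y \<oplus> y) \<ominus> z)"
    using assms by (simp only: M.minus_eq M.a_assoc M.a_inv_closed M.a_closed)
  also have "\<dots> = x \<ominus> z"
    using assms by (simp add: M.minus_eq M.l_neg)
  finally show ?thesis .
qed

lemma vminus_eq_zero: "x \<in> carrier X \<Longrightarrow> y \<in> carrier X \<Longrightarrow> x \<ominus> y = \<zero> \<longleftrightarrow> x = y"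
  by (metis M.l_zero vminus_add_cancel vminus_self)

lemma vdist_eq: "x \<in> carrier X \<Longrightarrow> y \<in> carrier X \<Longrightarrow> vdist X x y = vnorm X (x \<ominus> y)"
  by (simp add: vdist_def)

lemma vdist_zero: "x \<in> carrier X \<Longrightarrow> vdist X x \<zero> = vnorm X x"
  by (simp add: vdist_eq M.minus_eq)

end

sublocale complex_normed_space \<subseteq> metric: Metric_space "carrier X" "vdist X"
proof
  show "0 \<le> vdist X x y" for x y
    by (simp add: vdist_def vnorm_nonneg)
  show "vdist X x y = vdist X y x" for x y
  proof (cases "x \<in> carrier X \<and> y \<in> carrier X")
    case True
    then have "\<ominus> (x \<ominus> y) = y \<ominus> x"
      by (simp add: M.minus_eq M.minus_add M.add.m_comm)
    with True show ?thesis
      by (metis vdist_eq vminus_closed vnorm_minus)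
  qed (auto simp: vdist_def)
  show "vdist X x y = 0 \<longleftrightarrow> x = y" if "x \<in> carrier X" "y \<in> carrier X" for x y
    using that by (simp add: vdist_eq vnorm_eq_zero vminus_eq_zero)
  show "vdist X x z \<le> vdist X x y + vdist X y z"
    if "x \<in> carrier X" "y \<in> carrier X" "z \<in> carrier X" for x y z
    using that vnorm_triangle[of "x \<ominus> y" "y \<ominus> z"] by (simp add: vdist_eq vminus_add_vminus)
qed

context complex_normed_space
begin

lemma vdist_add_right:
  assumes "x \<in> carrier X" "y \<in> carrier X" "z \<in> carrier X"
  shows "vdist X (x \<oplus> z) (y \<oplus> z) = vdist X x y"
proof -
  have "(x \<oplus> z) \<ominus> (y \<oplus> z) = x \<ominus> y \<oplus> (z \<ominus> z)"
    using assms by (simp add: M.minus_eq M.minus_add M.a_ac)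
  then show ?thesis
    using assms by (simp add: vdist_eq)
qed

lemma vdist_add_left:
  "x \<in> carrier X \<Longrightarrow> y \<in> carrier X \<Longrightarrow> z \<in> carrier X \<Longrightarrow> vdist X (z \<oplus> x) (z \<oplus> y) = vdist X x y"
  using vdist_add_right by (simp add: M.add.m_comm)

lemma vdist_add_le:
  assumes "a \<in> carrier X" "b \<in> carrier X" "c \<in> carrier X" "d \<in> carrier X"
  shows "vdist X (a \<oplus> b) (c \<oplus> d) \<le> vdist X a c + vdist X b d"
  using assms metric.triangle[of "a \<oplus> b" "c \<oplus> b" "c \<oplus> d"]
  by (simp add: vdist_add_right vdist_add_left)


lemma vdist_smult:
  "x \<in> carrier X \<Longrightarrow> y \<in> carrier X \<Longrightarrow> vdist X (c \<odot> x) (c \<odot> y) = cmod c * vdist X x y"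
  by (simp add: vdist_eq vnorm_smult flip: vsmult_r_minus_distr)

lemma vdist_smult_left:
  "x \<in> carrier X \<Longrightarrow> vdist X (a \<odot> x) (b \<odot> x) = cmod (a - b) * vnorm X x"
  by (simp add: vdist_eq vnorm_smult flip: vsmult_l_minus_distr)

lemma vnorm_finsum_le:
  assumes "f \<in> A \<rightarrow> carrier X"
  shows "vnorm X (finsum X f A) \<le> (\<Sum>a\<in>A. vnorm X (f a))"
  using assms
proof (induction A rule: infinite_finite_induct)
  case (insert a A)
  then show ?case
    using vnorm_triangle[of "f a" "finsum X f A"] by (fastforce simp: Pi_iff)
qed (simp_all add: M.add.finprod_infinite)

lemma vdist_finsum_le:
  assumes "f \<in> A \<rightarrow> carrier X" "g \<in> A \<rightarrow> carrier X"
  shows "vdist X (finsum X f A) (finsum X g A) \<le> (\<Sum>a\<in>A. vdist X (f a) (g a))"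
  using assms
proof (induction A rule: infinite_finite_induct)
  case (insert a A)
  then show ?case
    using vdist_add_le[of "f a" "finsum X f A" "g a" "finsum X g A"] by (fastforce simp: Pi_iff)
qed (simp_all add: M.add.finprod_infinite)

lemma finsum_lessThan_Suc:
  "f \<in> {..<Suc n} \<rightarrow> carrier X \<Longrightarrow> finsum X f {..<Suc n} = finsum X f {..<n} \<oplus> f n"
  by (subst lessThan_Suc, subst M.finsum_insert) (auto simp: Pi_iff M.a_comm)

lemma finsum_lessThan_add:
  assumes "f \<in> UNIV \<rightarrow> carrier X"
  shows "finsum X f {..<m + n :: nat} = finsum X f {..<m} \<oplus> finsum X (\<lambda>k. f (m + k)) {..<n}"
proof (induction n)
  case (Suc n)
  have "f \<in> A \<rightarrow> carrier X" "(\<lambda>k. f (m + k)) \<in> A \<rightarrow> carrier X" for A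
    using assms by auto
  moreover have "f k \<in> carrier X" for k
    using assms by auto
  ultimately show ?case
    using Suc by (simp add: finsum_lessThan_Suc M.a_assoc)
qed (use assms in \<open>auto simp: Pi_iff\<close>)

lemma finsum_vsmult:
  assumes "f \<in> A \<rightarrow> carrier X"
  shows "finsum X (\<lambda>a. c \<odot> f a) A = c \<odot> finsum X f A"
  using assms
proof (induction A rule: infinite_finite_induct)
  case (insert a A)
  then show ?case
    by (simp add: Pi_iff vsmult_r_distr)
qed (simp_all add: M.add.finprod_infinite)

lemma finsum_const_vsmult:
  assumes "x \<in> carrier X"
  shows "finsum X (\<lambda>k. x) {..<n::nat} = of_nat n \<odot> x"
proof (induction n)
  case (Suc n)
  then show ?case
    using assms by (simp add: finsum_lessThan_Suc vsmult_l_distr M.a_comm)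
qed (use assms in simp)

end

section \<open>Bounded operators, functionals and limits in norm\<close>

lemma bounded_operatorD:
  assumes "bounded_operator X B"
  shows bounded_operator_closed: "x \<in> carrier X \<Longrightarrow> B x \<in> carrier X"
    and bounded_operator_add:
      "x \<in> carrier X \<Longrightarrow> y \<in> carrier X \<Longrightarrow> B (x \<oplus>\<^bsub>X\<^esub> y) = B x \<oplus>\<^bsub>X\<^esub> B y"
    and bounded_operator_smult: "x \<in> carrier X \<Longrightarrow> B (c \<odot>\<^bsub>X\<^esub> x) = c \<odot>\<^bsub>X\<^esub> B x"
  using assms by (auto simp: bounded_operator_def)

lemma dual_spaceD:
  assumes "\<phi> \<in> dual_space X"
  shows dual_add: "x \<in> carrier X \<Longrightarrow> y \<in> carrier X \<Longrightarrow> \<phi> (x \<oplus>\<^bsub>X\<^esub> y) = \<phi> x + \<phi> y"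
    and dual_smult: "x \<in> carrier X \<Longrightarrow> \<phi> (c \<odot>\<^bsub>X\<^esub> x) = c * \<phi> x"
  using assms by (auto simp: dual_space_def)

context complex_normed_space
begin

text \<open>Over the zero space the constant in the definition may be negative; its absolute value
  serves as well.\<close>

lemma bounded_operator_bound:
  assumes "bounded_operator X B"
  obtains C where "C \<ge> 0" "\<And>x. x \<in> carrier X \<Longrightarrow> vnorm X (B x) \<le> C * vnorm X x"
proof -
  obtain C where C: "\<And>x. x \<in> carrier X \<Longrightarrow> vnorm X (B x) \<le> C * vnorm X x"
    using assms unfolding bounded_operator_def by blast
  have "vnorm X (B x) \<le> \<bar>C\<bar> * vnorm X x" if "x \<in> carrier X" for x
    by (rule order_trans[OF C[OF that] mult_right_mono]) (auto simp: vnorm_nonneg that)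
  then show thesis
    using that[of "\<bar>C\<bar>"] by auto
qed

lemma bounded_operator_minus:
  assumes "bounded_operator X B" "x \<in> carrier X" "y \<in> carrier X"
  shows "B (x \<ominus> y) = B x \<ominus> B y"
proof -
  have "B (\<ominus> y) = \<ominus> B y"
    using assms by (simp add: vminus_eq_smult bounded_operatorD)
  then show ?thesis
    using assms by (simp add: M.minus_eq bounded_operatorD)
qed

lemma bounded_operator_zero: "bounded_operator X B \<Longrightarrow> B \<zero> = \<zero>"
  using bounded_operator_smult[of X B \<zero> 0] bounded_operator_closed[of X B \<zero>] by simp

lemma bounded_operator_finsum:
  assumes "bounded_operator X B" "f \<in> A \<rightarrow> carrier X"
  shows "B (finsum X f A) = finsum X (\<lambda>a. B (f a)) A"
  using assms(2)
proof (induction A rule: infinite_finite_induct)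
  case (insert a A)
  then show ?case
    using assms(1) by (simp add: Pi_iff bounded_operatorD)
qed (use assms(1) in \<open>simp_all add: bounded_operator_zero\<close>)

lemma vdist_bounded_operator_le:
  assumes "bounded_operator X B" "\<And>x. x \<in> carrier X \<Longrightarrow> vnorm X (B x) \<le> C * vnorm X x"
    and "x \<in> carrier X" "y \<in> carrier X"
  shows "vdist X (B x) (B y) \<le> C * vdist X x y"
  using assms by (simp add: vdist_eq bounded_operator_closed flip: bounded_operator_minus)

lemma norm_le_operator_norm:
  assumes "bounded_operator X B" "x \<in> carrier X"
  shows "vnorm X (B x) \<le> operator_norm X B * vnorm X x"
proof (cases "vnorm X x = 0")
  case True
  then show ?thesis
    using assms by (simp add: vnorm_eq_zero bounded_operator_zero)
next
  case False
  then have pos: "vnorm X x > 0"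
    using assms vnorm_nonneg[of x] by simp
  obtain C where C: "C \<ge> 0" "\<And>x. x \<in> carrier X \<Longrightarrow> vnorm X (B x) \<le> C * vnorm X x"
    using bounded_operator_bound[OF assms(1)] by blast
  \<comment> \<open>A real supremum dominates its members only if they are bounded above. The zero
    vector contributes \<open>0 / 0 = 0\<close>, which is where \<open>C \<ge> 0\<close>
    enters.\<close>
  have "vnorm X (B y) / vnorm X y \<le> C" if "y \<in> carrier X" for y
    using that C vnorm_nonneg[of y] by (cases "vnorm X y = 0") (auto simp: divide_le_eq)
  then have "bdd_above ((\<lambda>x. vnorm X (B x) / vnorm X x) ` carrier X)"
    by (intro bdd_aboveI2)
  then have "vnorm X (B x) / vnorm X x \<le> operator_norm X B"
    unfolding operator_norm_def by (rule cSUP_upper2) (use assms in auto)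
  then show ?thesis
    using pos by (simp add: divide_le_eq)
qed

text \<open>Turns every limit in norm into a real limit to 0, so that the limit laws below are
  sandwich arguments.\<close>

lemma limitin_norm_iff:
  "limitin (norm_topology X) f l F \<longleftrightarrow>
     l \<in> carrier X \<and> (\<forall>\<^sub>F x in F. f x \<in> carrier X) \<and> ((\<lambda>x. vdist X (f x) l) \<longlongrightarrow> 0) F"
  by (simp add: norm_topology_def metric.limitin_metric_dist_null)

lemma limitin_bounded_operator:
  assumes "bounded_operator X B" "limitin (norm_topology X) f l F"
  shows "limitin (norm_topology X) (\<lambda>x. B (f x)) (B l) F"
proof -
  have l: "l \<in> carrier X" "\<forall>\<^sub>F x in F. f x \<in> carrier X" "((\<lambda>x. vdist X (f x) l) \<longlongrightarrow> 0) F"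
    using assms(2) by (auto simp: limitin_norm_iff)
  obtain C where C: "C \<ge> 0" "\<And>x. x \<in> carrier X \<Longrightarrow> vnorm X (B x) \<le> C * vnorm X x"
    using bounded_operator_bound[OF assms(1)] by blast
  have "((\<lambda>x. vdist X (B (f x)) (B l)) \<longlongrightarrow> 0) F"
  proof (rule tendsto_sandwich[OF _ _ tendsto_const])
    show "((\<lambda>x. C * vdist X (f x) l) \<longlongrightarrow> 0) F"
      using tendsto_mult_left[OF l(3), of C] by simp
    show "\<forall>\<^sub>F x in F. vdist X (B (f x)) (B l) \<le> C * vdist X (f x) l"
      using l(2) by eventually_elim (use vdist_bounded_operator_le[OF assms(1) C(2)] l(1) in auto)
  qed auto
  moreover have "\<forall>\<^sub>F x in F. B (f x) \<in> carrier X"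
    using l(2) by eventually_elim (use assms(1) in \<open>auto intro: bounded_operator_closed\<close>)
  ultimately show ?thesis
    using l(1) assms(1) by (auto simp: limitin_norm_iff intro: bounded_operator_closed)
qed

lemma limitin_norm_add:
  assumes "limitin (norm_topology X) f l F" "limitin (norm_topology X) g m F"
  shows "limitin (norm_topology X) (\<lambda>x. f x \<oplus> g x) (l \<oplus> m) F"
proof -
  have l: "l \<in> carrier X" "\<forall>\<^sub>F x in F. f x \<in> carrier X" "((\<lambda>x. vdist X (f x) l) \<longlongrightarrow> 0) F"
    and m: "m \<in> carrier X" "\<forall>\<^sub>F x in F. g x \<in> carrier X" "((\<lambda>x. vdist X (g x) m) \<longlongrightarrow> 0) F"
    using assms by (auto simp: limitin_norm_iff)
  have "((\<lambda>x. vdist X (f x \<oplus> g x) (l \<oplus> m)) \<longlongrightarrow> 0) F"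
  proof (rule tendsto_sandwich[OF _ _ tendsto_const])
    show "((\<lambda>x. vdist X (f x) l + vdist X (g x) m) \<longlongrightarrow> 0) F"
      using tendsto_add[OF l(3) m(3)] by simp
    show "\<forall>\<^sub>F x in F. vdist X (f x \<oplus> g x) (l \<oplus> m) \<le> vdist X (f x) l + vdist X (g x) m"
      using l(2) m(2) by eventually_elim (use l(1) m(1) vdist_add_le in auto)
  qed auto
  moreover have "\<forall>\<^sub>F x in F. f x \<oplus> g x \<in> carrier X"
    using l(2) m(2) by eventually_elim auto
  ultimately show ?thesis
    using l(1) m(1) by (auto simp: limitin_norm_iff)
qed

lemma limitin_norm_smult:
  assumes "(c \<longlongrightarrow> a) F" "limitin (norm_topology X) f l F"
  shows "limitin (norm_topology X) (\<lambda>x. c x \<odot> f x) (a \<odot> l) F"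
proof -
  have l: "l \<in> carrier X" "\<forall>\<^sub>F x in F. f x \<in> carrier X" "((\<lambda>x. vdist X (f x) l) \<longlongrightarrow> 0) F"
    using assms(2) by (auto simp: limitin_norm_iff)
  have "((\<lambda>x. vdist X (c x \<odot> f x) (a \<odot> l)) \<longlongrightarrow> 0) F"
  proof (rule tendsto_sandwich[OF _ _ tendsto_const])
    have "((\<lambda>x. cmod (c x) * vdist X (f x) l + cmod (c x - a) * vnorm X l)
        \<longlongrightarrow> cmod a * 0 + cmod (a - a) * vnorm X l) F"
      by (intro tendsto_intros assms l)
    then show "((\<lambda>x. cmod (c x) * vdist X (f x) l + cmod (c x - a) * vnorm X l) \<longlongrightarrow> 0) F"
      by simp
    show "\<forall>\<^sub>F x in F. vdist X (c x \<odot> f x) (a \<odot> l) \<le>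
        cmod (c x) * vdist X (f x) l + cmod (c x - a) * vnorm X l"
      using l(2)
    proof eventually_elim
      case (elim x)
      have "vdist X (c x \<odot> f x) (a \<odot> l) \<le>
          vdist X (c x \<odot> f x) (c x \<odot> l) + vdist X (c x \<odot> l) (a \<odot> l)"
        using elim l(1) by (intro metric.triangle) auto
      then show ?case
        using elim l(1) by (simp add: vdist_smult vdist_smult_left)
    qed
  qed auto
  moreover have "\<forall>\<^sub>F x in F. c x \<odot> f x \<in> carrier X"
    using l(2) by eventually_elim auto
  ultimately show ?thesis
    using l(1) by (auto simp: limitin_norm_iff)
qed

lemma limitin_norm_const: "x \<in> carrier X \<Longrightarrow> limitin (norm_topology X) (\<lambda>_. x) x F"
  unfolding norm_topology_def by simp

lemma limitin_norm_unique:
  "limitin (norm_topology X) f l F \<Longrightarrow> limitin (norm_topology X) f m F \<Longrightarrow> F \<noteq> bot \<Longrightarrow> l = m"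
  unfolding norm_topology_def by (rule metric.limitin_metric_unique)

lemma tendsto_vdist:
  assumes "limitin (norm_topology X) f l F" "limitin (norm_topology X) g m F"
  shows "((\<lambda>x. vdist X (f x) (g x)) \<longlongrightarrow> vdist X l m) F"
proof (rule Lim_transform)
  have l: "l \<in> carrier X" "\<forall>\<^sub>F x in F. f x \<in> carrier X" "((\<lambda>x. vdist X (f x) l) \<longlongrightarrow> 0) F"
    and m: "m \<in> carrier X" "\<forall>\<^sub>F x in F. g x \<in> carrier X" "((\<lambda>x. vdist X (g x) m) \<longlongrightarrow> 0) F"
    using assms by (auto simp: limitin_norm_iff)
  show "((\<lambda>x. vdist X (f x) (g x) - vdist X l m) \<longlongrightarrow> 0) F"
  proof (rule Lim_null_comparison)
    show "((\<lambda>x. vdist X (f x) l + vdist X (g x) m) \<longlongrightarrow> 0) F"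
      using tendsto_add[OF l(3) m(3)] by simp
    show "\<forall>\<^sub>F x in F. norm (vdist X (f x) (g x) - vdist X l m) \<le> vdist X (f x) l + vdist X (g x) m"
      using l(2) m(2)
    proof eventually_elim
      case (elim x)
      then show ?case
        using metric.triangle[of "f x" l "g x"] metric.triangle[of l m "g x"]
          metric.triangle[of l "f x" m] metric.triangle[of "f x" "g x" m] l(1) m(1)
          metric.commute[of l "f x"] metric.commute[of m "g x"]
        by auto
    qed
  qed
qed auto

lemma dual_bound:
  assumes "\<phi> \<in> dual_space X"
  obtains C where "C \<ge> 0" "\<And>x. x \<in> carrier X \<Longrightarrow> cmod (\<phi> x) \<le> C * vnorm X x"
proof -
  obtain C where C: "\<And>x. x \<in> carrier X \<Longrightarrow> cmod (\<phi> x) \<le> C * vnorm X x"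
    using assms unfolding dual_space_def by blast
  have "cmod (\<phi> x) \<le> \<bar>C\<bar> * vnorm X x" if "x \<in> carrier X" for x
    by (rule order_trans[OF C[OF that] mult_right_mono]) (auto simp: vnorm_nonneg that)
  then show thesis
    using that[of "\<bar>C\<bar>"] by auto
qed

lemma dual_minus:
  assumes "\<phi> \<in> dual_space X" "x \<in> carrier X" "y \<in> carrier X"
  shows "\<phi> (x \<ominus> y) = \<phi> x - \<phi> y"
  using assms by (simp add: M.minus_eq vminus_eq_smult dual_spaceD del: M.add.m_comm)

lemma dual_zero: "\<phi> \<in> dual_space X \<Longrightarrow> \<phi> \<zero> = 0"
  using dual_smult[of \<phi> X \<zero> 0] by simp

lemma dual_finsum:
  assumes "\<phi> \<in> dual_space X" "f \<in> A \<rightarrow> carrier X"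
  shows "\<phi> (finsum X f A) = (\<Sum>a\<in>A. \<phi> (f a))"
  using assms(2)
proof (induction A rule: infinite_finite_induct)
  case (insert a A)
  then show ?case
    using assms(1) by (simp add: Pi_iff dual_spaceD)
qed (use assms(1) in \<open>simp_all add: dual_zero M.add.finprod_infinite\<close>)

lemma tendsto_dual:
  assumes "\<phi> \<in> dual_space X" "limitin (norm_topology X) f l F"
  shows "((\<lambda>x. \<phi> (f x)) \<longlongrightarrow> \<phi> l) F"
proof (rule Lim_transform)
  have l: "l \<in> carrier X" "\<forall>\<^sub>F x in F. f x \<in> carrier X" "((\<lambda>x. vdist X (f x) l) \<longlongrightarrow> 0) F"
    using assms(2) by (auto simp: limitin_norm_iff)
  obtain C where C: "C \<ge> 0" "\<And>x. x \<in> carrier X \<Longrightarrow> cmod (\<phi> x) \<le> C * vnorm X x"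
    using dual_bound[OF assms(1)] by blast
  show "((\<lambda>x. \<phi> (f x) - \<phi> l) \<longlongrightarrow> 0) F"
  proof (rule Lim_null_comparison)
    show "((\<lambda>x. C * vdist X (f x) l) \<longlongrightarrow> 0) F"
      using tendsto_mult_left[OF l(3), of C] by simp
    show "\<forall>\<^sub>F x in F. cmod (\<phi> (f x) - \<phi> l) \<le> C * vdist X (f x) l"
      using l(2)
      by eventually_elim (use C l(1) assms(1) in \<open>simp add: vdist_eq flip: dual_minus\<close>)
  qed
qed auto

section \<open>The weak topology\<close>

lemma topspace_weak_topology: "topspace (weak_topology X) = carrier X"
proof -
  \<comment> \<open>The preimage of \<open>UNIV\<close> under the zero functional is the whole
    carrier, so the generating sets cover it.\<close>
  have "(\<lambda>_. 0) \<in> dual_space X"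
    by (auto simp: dual_space_def intro: exI[of _ 0])
  then have "carrier X \<in> {{x \<in> carrier X. \<phi> x \<in> U} |\<phi> U. \<phi> \<in> dual_space X \<and> open U}"
    by (intro CollectI exI[of _ "\<lambda>_. 0"] exI[of _ UNIV]) auto
  then show ?thesis
    unfolding weak_topology_def topology_generated_by_topspace by blast
qed

text \<open>Eventual membership is inherited by finite intersections and by unions, so it has to be
  tested only on the preimages under single functionals that generate the topology.\<close>

lemma weakly_converges_iff:
  assumes xs: "\<And>n. xs n \<in> carrier X"
  shows "weakly_converges X xs x \<longleftrightarrow>
    x \<in> carrier X \<and> (\<forall>\<phi>\<in>dual_space X. (\<lambda>n. \<phi> (xs n)) \<longlonglongrightarrow> \<phi> x)"
proof safe
  assume lim: "weakly_converges X xs x"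
  then show x: "x \<in> carrier X"
    using limitin_topspace topspace_weak_topology unfolding weakly_converges_def by metis
  fix \<phi> assume \<phi>: "\<phi> \<in> dual_space X"
  show "(\<lambda>n. \<phi> (xs n)) \<longlonglongrightarrow> \<phi> x"
  proof (rule topological_tendstoI)
    fix U assume U: "open U" "\<phi> x \<in> U"
    then have "openin (weak_topology X) {x \<in> carrier X. \<phi> x \<in> U}"
      unfolding weak_topology_def by (intro topology_generated_by_Basis) (use \<phi> in blast)
    then have "\<forall>\<^sub>F n in sequentially. xs n \<in> {x \<in> carrier X. \<phi> x \<in> U}"
      using lim x U by (auto simp: weakly_converges_def limitin_def)
    then show "\<forall>\<^sub>F n in sequentially. \<phi> (xs n) \<in> U"
      by (rule eventually_mono) auto
  qed
next
  assume x: "x \<in> carrier X" and lim: "\<forall>\<phi>\<in>dual_space X. (\<lambda>n. \<phi> (xs n)) \<longlonglongrightarrow> \<phi> x"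
  have "\<forall>\<^sub>F n in sequentially. xs n \<in> U"
    if "generate_topology_on {{x \<in> carrier X. \<phi> x \<in> U} |\<phi> U. \<phi> \<in> dual_space X \<and> open U} U" "x \<in> U"
    for U
    using that
  proof (induction rule: generate_topology_on.induct)
    case (Int U V)
    then show ?case
      by (auto intro: eventually_conj)
  next
    case (UN K)
    then obtain k where "k \<in> K" "x \<in> k"
      by auto
    with UN have "\<forall>\<^sub>F n in sequentially. xs n \<in> k"
      by blast
    then show ?case
      by (rule eventually_mono) (use \<open>k \<in> K\<close> in auto)
  next
    case (Basis S)
    then obtain \<phi> V where "S = {x \<in> carrier X. \<phi> x \<in> V}" "\<phi> \<in> dual_space X" "open V"
      by auto
    with Basis lim xs show ?case
      by (auto intro: topological_tendstoD)
  qed auto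
  then show "weakly_converges X xs x"
    using x unfolding weakly_converges_def limitin_def topspace_weak_topology
    by (simp add: weak_topology_def openin_topology_generated_by_iff)
qed

end

section \<open>The Laplace transform of a decaying semigroup\<close>

lemma C0_semigroupD:
  assumes "C0_semigroup X T"
  shows C0_semigroup_bounded: "t \<ge> 0 \<Longrightarrow> bounded_operator X (T t)"
    and C0_semigroup_zero: "x \<in> carrier X \<Longrightarrow> T 0 x = x"
    and C0_semigroup_add: "s \<ge> 0 \<Longrightarrow> t \<ge> 0 \<Longrightarrow> x \<in> carrier X \<Longrightarrow> T (s + t) x = T s (T t x)"
    and C0_semigroup_closed: "t \<ge> 0 \<Longrightarrow> x \<in> carrier X \<Longrightarrow> T t x \<in> carrier X"
  using assms by (auto simp: C0_semigroup_def intro: bounded_operator_closed)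

text \<open>The filter and the time \<open>h\<close> are left free because orbits are followed along
  \<open>at_right 0\<close>, within the half line, and along dyadic sequences.\<close>

lemma C0_semigroup_limitin:
  assumes "C0_semigroup X T" "x \<in> carrier X" "s \<ge> 0"
    and "(h \<longlongrightarrow> s) F" "\<forall>\<^sub>F y in F. h y \<ge> 0"
  shows "limitin (norm_topology X) (\<lambda>y. T (h y) x) (T s x) F"
proof -
  have "continuous_map (top_of_set {0..}) (norm_topology X) (\<lambda>t. T t x)"
    using assms by (auto simp: C0_semigroup_def)
  moreover have "limitin (top_of_set {0..}) h s F"
    using assms by (auto simp: limitin_subtopology)
  ultimately show ?thesis
    using continuous_map_limit[of "top_of_set {0..}" _ "\<lambda>t. T t x" h s F] by (simp add: o_def)
qed

text \<open>A left Riemann sum of \<open>exp (- a * t)\<close> exceeds the integral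
  \<open>1 / a\<close> over the half line by at most one step. The geometric series gives
  \<open>h / (1 - q)\<close>, and \<open>exp (a * h) \<ge> 1 + a * h\<close> bounds it.\<close>

lemma sum_exp_le:
  assumes "a > 0" "h > 0"
  shows "h * (\<Sum>k<K. exp (- a * (real k * h))) \<le> 1 / a + h"
proof -
  define q where "q = exp (- a * h)"
  have q: "0 < q" "q < 1"
    using assms by (auto simp: q_def)
  have "exp (- a * (real k * h)) = q ^ k" for k
    by (simp add: q_def mult_ac flip: exp_of_nat_mult)
  then have "(\<Sum>k<K. exp (- a * (real k * h))) = (\<Sum>k<K. q ^ k)"
    by simp
  also have "\<dots> = (1 - q ^ K) / (1 - q)"
    using q by (simp add: sum_gp_strict)
  also have "\<dots> \<le> 1 / (1 - q)"
    using q by (intro divide_right_mono) auto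
  also have "\<dots> \<le> (1 + a * h) / (a * h)"
  proof -
    have "q * (1 + a * h) \<le> q * exp (a * h)"
      using q by (intro mult_left_mono exp_ge_add_one_self) auto
    also have "\<dots> = 1"
      by (simp add: q_def flip: exp_add)
    finally have "a * h \<le> (1 + a * h) * (1 - q)"
      by (simp add: algebra_simps)
    then show ?thesis
      using assms q by (simp add: field_simps)
  qed
  finally have "h * (\<Sum>k<K. exp (- a * (real k * h))) \<le> h * ((1 + a * h) / (a * h))"
    using assms by (intro mult_left_mono) auto
  also have "\<dots> = 1 / a + h"
    using assms by (simp add: field_simps)
  finally show ?thesis .
qed

text \<open>With left end points the one-term sum is just \<open>h\<close> times the vector, which
  lets a whole block of a sum be read as one term of a coarser sum.\<close>

definition riemann_sum ::
    "'a normed_module \<Rightarrow> (real \<Rightarrow> 'a \<Rightarrow> 'a) \<Rightarrow> real \<Rightarrow> nat \<Rightarrow> 'a \<Rightarrow> 'a" where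
  "riemann_sum X S h K x =
     complex_of_real h \<odot>\<^bsub>X\<^esub> finsum X (\<lambda>k. S (real k * h) x) {..<K}"

locale decaying_semigroup = complex_banach_space X for X :: "'a normed_module" (structure) +
  fixes S :: "real \<Rightarrow> 'a \<Rightarrow> 'a" and M \<delta> :: real
  assumes C0: "C0_semigroup X S"
    and M_nonneg: "M \<ge> 0"
    and \<delta>_pos: "\<delta> > 0"
    and bound: "t \<ge> 0 \<Longrightarrow> x \<in> carrier X \<Longrightarrow> vnorm X (S t x) \<le> M * exp (- \<delta> * t) * vnorm X x"
begin

abbreviation rs :: "real \<Rightarrow> nat \<Rightarrow> 'a \<Rightarrow> 'a" where "rs \<equiv> riemann_sum X S"

section \<open>Riemann sums of a decaying orbit\<close>

lemma S_closed [simp, intro]: "t \<ge> 0 \<Longrightarrow> x \<in> carrier X \<Longrightarrow> S t x \<in> carrier X"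
  using C0_semigroup_closed[OF C0] by blast

lemma orbit_Pi: "h \<ge> 0 \<Longrightarrow> x \<in> carrier X \<Longrightarrow> (\<lambda>k::nat. S (real k * h) x) \<in> A \<rightarrow> carrier X"
  by auto

lemma rs_closed [simp, intro]: "h \<ge> 0 \<Longrightarrow> x \<in> carrier X \<Longrightarrow> rs h K x \<in> carrier X"
  by (auto simp: riemann_sum_def orbit_Pi)

text \<open>Discrete splitting of an integral at time \<open>m * h\<close>: by the semigroup law the
  remainder is a time shift of a sum that starts at 0.\<close>

lemma rs_add:
  assumes "h \<ge> 0" "x \<in> carrier X"
  shows "rs h (m + K) x = rs h m x \<oplus> S (real m * h) (rs h K x)"
proof -
  have *: "S (real m * h) (S (real k * h) x) = S (real (m + k) * h) x" for k
    using assms C0_semigroup_add[OF C0, of "real m * h" "real k * h" x] by (simp add: ring_distribs)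
  have "S (real m * h) (rs h K x) =
      complex_of_real h \<odot> finsum X (\<lambda>k. S (real (m + k) * h) x) {..<K}"
    using assms C0_semigroup_bounded[OF C0, of "real m * h"]
    by (simp add: riemann_sum_def bounded_operator_smult bounded_operator_finsum orbit_Pi *
        del: of_nat_add)
  moreover have "(\<lambda>k. S (real (m + k) * h) x) \<in> {..<K} \<rightarrow> carrier X"
    using assms by auto
  ultimately show ?thesis
    using assms by (simp add: riemann_sum_def finsum_lessThan_add orbit_Pi vsmult_r_distr
        del: of_nat_add)
qed

text \<open>The geometric series bounds the sum by \<open>1 / \<delta> + h\<close>; with
  \<open>h \<le> 1\<close> the step disappears from the constant, so one bound serves all meshes and
  all horizons.\<close>

lemma vnorm_rs_le:
  assumes "0 < h" "h \<le> 1" "x \<in> carrier X"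
  shows "vnorm X (rs h K x) \<le> M * (1 / \<delta> + 1) * vnorm X x"
proof -
  have "vnorm X (rs h K x) \<le> h * (\<Sum>k<K. vnorm X (S (real k * h) x))"
    using assms by (simp add: riemann_sum_def vnorm_smult vnorm_finsum_le orbit_Pi)
  also have "\<dots> \<le> h * (\<Sum>k<K. M * exp (- \<delta> * (real k * h)) * vnorm X x)"
    using assms by (intro mult_left_mono sum_mono bound) auto
  also have "\<dots> = M * (h * (\<Sum>k<K. exp (- \<delta> * (real k * h)))) * vnorm X x"
    by (simp add: sum_distrib_left sum_distrib_right mult_ac)
  also have "\<dots> \<le> M * (1 / \<delta> + 1) * vnorm X x"
    using assms sum_exp_le[OF \<delta>_pos assms(1), of K] M_nonneg
    by (intro mult_right_mono mult_left_mono) (auto simp: vnorm_nonneg)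
  finally show ?thesis .
qed

lemma bounded_operator_rs:
  assumes "0 < h" "h \<le> 1"
  shows "bounded_operator X (rs h K)"
proof -
  note S = C0_semigroup_bounded[OF C0]
  have "rs h K (x \<oplus> y) = rs h K x \<oplus> rs h K y" if "x \<in> carrier X" "y \<in> carrier X" for x y
  proof -
    have "finsum X (\<lambda>k. S (real k * h) (x \<oplus> y)) {..<K} =
        finsum X (\<lambda>k. S (real k * h) x \<oplus> S (real k * h) y) {..<K}"
      using assms that by (intro M.finsum_cong') (auto simp: bounded_operator_add[OF S])
    then show ?thesis
      using assms that by (simp add: riemann_sum_def M.finsum_addf orbit_Pi vsmult_r_distr)
  qed
  moreover have "rs h K (c \<odot> x) = c \<odot> rs h K x" if "x \<in> carrier X" for c x
  proof -
    have "finsum X (\<lambda>k. S (real k * h) (c \<odot> x)) {..<K} =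
        finsum X (\<lambda>k. c \<odot> S (real k * h) x) {..<K}"
      using assms that by (intro M.finsum_cong') (auto simp: bounded_operator_smult[OF S])
    then show ?thesis
      using assms that
      by (simp add: riemann_sum_def finsum_vsmult orbit_Pi mult.commute flip: vsmult_assoc)
  qed
  ultimately show ?thesis
    using assms vnorm_rs_le[OF assms] by (auto simp: bounded_operator_def intro!: exI[of _ "M * (1 / \<delta> + 1)"])
qed

lemma vdist_rs_le:
  assumes "0 < h" "h \<le> 1" "x \<in> carrier X" "y \<in> carrier X"
  shows "vdist X (rs h K x) (rs h K y) \<le> M * (1 / \<delta> + 1) * vdist X x y"
  using assms by (intro vdist_bounded_operator_le bounded_operator_rs vnorm_rs_le)

text \<open>By the semigroup law \<open>J\<close> consecutive fine terms are one term of step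
  \<open>J * h\<close>, taken at the average of the orbit over the first block. Passing to a finer
  mesh thus only replaces \<open>x\<close> by that average.\<close>

lemma rs_mult:
  assumes "h > 0" "J > 0" "x \<in> carrier X"
  shows "rs h (J * K) x = rs (real J * h) K (complex_of_real (1 / (real J * h)) \<odot> rs h J x)"
proof (induction K)
  case 0
  then show ?case
    using assms by (simp add: riemann_sum_def)
next
  case (Suc K)
  define y where "y = complex_of_real (1 / (real J * h)) \<odot> rs h J x"
  have y: "y \<in> carrier X"
    using assms by (simp add: y_def)
  have J: "rs h J x = complex_of_real (real J * h) \<odot> y"
    using assms by (simp add: y_def flip: vsmult_assoc)
  have 1: "rs (real J * h) 1 y = complex_of_real (real J * h) \<odot> y"
    using assms y by (simp add: riemann_sum_def lessThan_Suc C0_semigroup_zero[OF C0])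
  have "rs h (J * Suc K) x = rs h (J * K) x \<oplus> S (real (J * K) * h) (rs h J x)"
    using rs_add[of h x "J * K" J] assms by (simp add: add.commute)
  also have "\<dots> = rs (real J * h) K y \<oplus> S (real K * (real J * h)) (rs (real J * h) 1 y)"
    unfolding y_def[symmetric] 1 J[symmetric] using Suc by (simp add: y_def mult_ac)
  also have "\<dots> = rs (real J * h) (Suc K) y"
    using rs_add[of "real J * h" y K 1] assms y by simp
  finally show ?case
    by (simp add: y_def)
qed

text \<open>Serves twice: block averages are close to \<open>x\<close>, and the integral over a
  short interval \<open>[0, h]\<close> is close to \<open>h\<close> times \<open>x\<close>.\<close>

lemma vdist_rs_vsmult_le:
  assumes "h \<ge> 0" "x \<in> carrier X"
    and "\<And>t. 0 \<le> t \<Longrightarrow> t \<le> real K * h \<Longrightarrow> vdist X (S t x) x \<le> \<epsilon>"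
  shows "vdist X (rs h K x) (complex_of_real (real K * h) \<odot> x) \<le> real K * h * \<epsilon>"
proof -
  have "complex_of_real (real K * h) \<odot> x = complex_of_real h \<odot> finsum X (\<lambda>k. x) {..<K}"
    using assms by (simp add: finsum_const_vsmult mult.commute flip: vsmult_assoc)
  then have "vdist X (rs h K x) (complex_of_real (real K * h) \<odot> x) =
      h * vdist X (finsum X (\<lambda>k. S (real k * h) x) {..<K}) (finsum X (\<lambda>k. x) {..<K})"
    using assms by (simp add: riemann_sum_def vdist_smult orbit_Pi)
  also have "\<dots> \<le> h * (\<Sum>k<K. vdist X (S (real k * h) x) x)"
    using assms by (intro mult_left_mono vdist_finsum_le) auto
  also have "\<dots> \<le> h * (\<Sum>k<K. \<epsilon>)"
    using assms by (intro mult_left_mono sum_mono assms mult_right_mono) auto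
  finally show ?thesis
    by (simp add: mult_ac)
qed

lemma orbit_near_zero:
  assumes "x \<in> carrier X" "\<epsilon> > 0"
  obtains d where "d > 0" "\<And>t. 0 \<le> t \<Longrightarrow> t \<le> d \<Longrightarrow> vdist X (S t x) x \<le> \<epsilon>"
proof -
  have "limitin (norm_topology X) (\<lambda>t. S t x) (S 0 x) (at_right 0)"
    using assms(1) by (intro C0_semigroup_limitin[OF C0])
      (auto simp: eventually_at_right_less intro: eventually_mono[OF eventually_at_right_less])
  then have "((\<lambda>t. vdist X (S t x) x) \<longlongrightarrow> 0) (at_right 0)"
    using assms(1) by (simp add: limitin_norm_iff C0_semigroup_zero[OF C0])
  then have "\<forall>\<^sub>F t in at_right 0. vdist X (S t x) x < \<epsilon>"
    using assms(2) by (rule order_tendstoD)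
  then obtain b where b: "b > 0" "\<And>t. 0 < t \<Longrightarrow> t < b \<Longrightarrow> vdist X (S t x) x < \<epsilon>"
    by (auto simp: eventually_at_right_field)
  have "vdist X (S t x) x \<le> \<epsilon>" if "0 \<le> t" "t \<le> b / 2" for t
  proof (cases "t = 0")
    case True
    then show ?thesis
      using assms by (simp add: C0_semigroup_zero[OF C0])
  next
    case False
    then show ?thesis
      using b(2)[of t] that b(1) by simp
  qed
  then show thesis
    using that[of "b / 2"] b(1) by auto
qed

text \<open>Step and horizon share one index, so a single sequence refines the mesh and exhausts the
  half line at once. Powers of two make each mesh a subdivision of the earlier ones.\<close>

definition approx :: "nat \<Rightarrow> 'a \<Rightarrow> 'a" where
  "approx n = rs (1 / 2 ^ n) (n * 2 ^ n)"

lemma approx_closed [simp, intro]: "x \<in> carrier X \<Longrightarrow> approx n x \<in> carrier X"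
  by (simp add: approx_def)

lemma bounded_operator_approx: "bounded_operator X (approx n)"
  unfolding approx_def by (rule bounded_operator_rs) auto

lemma vnorm_approx_le: "x \<in> carrier X \<Longrightarrow> vnorm X (approx n x) \<le> M * (1 / \<delta> + 1) * vnorm X x"
  unfolding approx_def by (rule vnorm_rs_le) auto

lemma vnorm_S_rs_le:
  assumes "0 < h" "h \<le> 1" "x \<in> carrier X" "t \<ge> 0"
  shows "vnorm X (S t (rs h K x)) \<le> M * exp (- \<delta> * t) * (M * (1 / \<delta> + 1) * vnorm X x)"
proof -
  have "vnorm X (S t (rs h K x)) \<le> M * exp (- \<delta> * t) * vnorm X (rs h K x)"
    using assms by (intro bound) auto
  also have "\<dots> \<le> M * exp (- \<delta> * t) * (M * (1 / \<delta> + 1) * vnorm X x)"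
    using assms M_nonneg by (intro mult_left_mono vnorm_rs_le) auto
  finally show ?thesis .
qed

lemma vdist_add_self: "x \<in> carrier X \<Longrightarrow> y \<in> carrier X \<Longrightarrow> vdist X (x \<oplus> y) x = vnorm X y"
  using vdist_add_left[of y \<zero> x] by (simp add: vdist_zero)

text \<open>The two terms are two separate errors. Up to time \<open>N\<close> the finer sum is the
  coarse sum of a block average in place of \<open>x\<close>; beyond time \<open>N\<close> it is a
  shifted sum, damped by \<open>exp (- \<delta> * N)\<close>.\<close>

lemma vdist_approx_le:
  assumes "x \<in> carrier X" "N \<le> m"
    and near: "\<And>t. 0 \<le> t \<Longrightarrow> t \<le> 1 / 2 ^ N \<Longrightarrow> vdist X (S t x) x \<le> \<epsilon>"
  shows "vdist X (approx m x) (approx N x) \<le>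
    M * (1 / \<delta> + 1) * \<epsilon> + M * exp (- \<delta> * N) * (M * (1 / \<delta> + 1) * vnorm X x)"
proof -
  define h :: real where "h = 1 / 2 ^ m"
  define H :: real where "H = 1 / 2 ^ N"
  define J :: nat where "J = 2 ^ (m - N)"
  define K where "K = N * 2 ^ N"
  have h: "0 < h" "h \<le> 1" and H: "0 < H" "H \<le> 1" and J: "J > 0"
    by (simp_all add: h_def H_def J_def)
  have JN: "J * 2 ^ N = 2 ^ m"
    using assms by (simp add: J_def flip: power_add)
  then have "real J * 2 ^ N = 2 ^ m"
    by (metis of_nat_mult of_nat_numeral of_nat_power)
  then have JH: "real J * h = H"
    by (simp add: h_def H_def field_simps)
  have Nm: "N * 2 ^ m \<le> m * 2 ^ m"
    using assms by simp
  have JK: "J * K = N * 2 ^ m"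
    using JN by (simp add: K_def mult_ac)
  then have time: "real (J * K) * h = real N"
    by (simp add: h_def)
  \<comment> \<open>The mean of the orbit over one coarse step of length \<open>H\<close>; it lies
    within \<open>\<epsilon>\<close> of \<open>x\<close> because the orbit does so on
    \<open>[0, H]\<close>.\<close>
  define y where "y = complex_of_real (1 / H) \<odot> rs h J x"
  have y: "y \<in> carrier X"
    using assms h by (simp add: y_def)
  have "x = complex_of_real (1 / H) \<odot> (complex_of_real (real J * h) \<odot> x)"
    using assms H by (simp add: JH flip: vsmult_assoc)
  then have "vdist X y x =
      1 / H * vdist X (rs h J x) (complex_of_real (real J * h) \<odot> x)"
    using assms h H vdist_smult[of "rs h J x" "complex_of_real (real J * h) \<odot> x" "complex_of_real (1 / H)"]
    by (simp add: y_def norm_divide)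
  also have "\<dots> \<le> 1 / H * (real J * h * \<epsilon>)"
    using assms h H near by (intro mult_left_mono vdist_rs_vsmult_le) (auto simp: JH H_def)
  finally have yx: "vdist X y x \<le> \<epsilon>"
    using H by (simp add: JH)
  \<comment> \<open>The number of fine steps that remain after time \<open>N\<close>.\<close>
  define L where "L = m * 2 ^ m - J * K"
  have "approx m x = rs h (J * K + L) x"
    using Nm by (simp add: approx_def h_def L_def JK)
  also have "\<dots> = rs h (J * K) x \<oplus> S (real N) (rs h L x)"
    using h assms rs_add[of h x "J * K" L] time by simp
  also have "rs h (J * K) x = rs H K y"
    using h assms J by (simp add: rs_mult JH y_def)
  finally have eq: "approx m x = rs H K y \<oplus> S (real N) (rs h L x)" .
  have "vdist X (approx m x) (approx N x) \<le>
      vdist X (approx m x) (rs H K y) + vdist X (rs H K y) (approx N x)"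
    using assms H y by (intro metric.triangle) auto
  also have "vdist X (approx m x) (rs H K y) = vnorm X (S (real N) (rs h L x))"
    using eq assms h H y by (simp add: vdist_add_self)
  also have "\<dots> \<le> M * exp (- \<delta> * N) * (M * (1 / \<delta> + 1) * vnorm X x)"
    using assms h by (intro vnorm_S_rs_le) auto
  also have "vdist X (rs H K y) (approx N x) \<le> M * (1 / \<delta> + 1) * vdist X y x"
    using assms H y vdist_rs_le[of H y x K] by (simp add: approx_def H_def K_def)
  also have "\<dots> \<le> M * (1 / \<delta> + 1) * \<epsilon>"
    using M_nonneg \<delta>_pos yx by (intro mult_left_mono) auto
  finally show ?thesis
    by simp
qed

lemma approx_MCauchy:
  assumes x: "x \<in> carrier X"
  shows "metric.MCauchy (\<lambda>n. approx n x)"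
  unfolding metric.MCauchy_def
proof (intro conjI allI impI)
  show "range (\<lambda>n. approx n x) \<subseteq> carrier X"
    using x by auto
  fix e :: real assume "e > 0"
  define C where "C = M * (1 / \<delta> + 1)"
  have C: "C \<ge> 0"
    using M_nonneg \<delta>_pos by (simp add: C_def)
  \<comment> \<open>Dividing by \<open>C + 1\<close> rather than \<open>C\<close> allows for
    \<open>C = 0\<close>. Each of the two errors is then at most \<open>e / 4\<close>, and comparing
    two indices through \<open>N\<close> doubles their sum.\<close>
  define \<epsilon> where "\<epsilon> = (e / 4) / (C + 1)"
  have \<epsilon>: "\<epsilon> > 0"
    using \<open>e > 0\<close> C by (simp add: \<epsilon>_def)
  obtain d where d: "d > 0" "\<And>t. 0 \<le> t \<Longrightarrow> t \<le> d \<Longrightarrow> vdist X (S t x) x \<le> \<epsilon>"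
    using orbit_near_zero[OF x \<epsilon>] by blast
  have "(\<lambda>n::nat. 1 / 2 ^ n :: real) \<longlonglongrightarrow> 0"
    by real_asymp
  then have 1: "\<forall>\<^sub>F n in sequentially. 1 / 2 ^ n < d"
    using d(1) by (rule order_tendstoD)
  have "(\<lambda>n::nat. exp (- \<delta> * n)) \<longlonglongrightarrow> 0"
    using \<delta>_pos by real_asymp
  then have "(\<lambda>n::nat. M * exp (- \<delta> * n) * (C * vnorm X x)) \<longlonglongrightarrow> M * 0 * (C * vnorm X x)"
    by (intro tendsto_intros)
  then have 2: "\<forall>\<^sub>F n::nat in sequentially. M * exp (- \<delta> * n) * (C * vnorm X x) < e / 4"
    by (rule order_tendstoD) (use \<open>e > 0\<close> in auto)
  obtain N :: nat where N: "1 / 2 ^ N < d" "M * exp (- \<delta> * N) * (C * vnorm X x) < e / 4"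
    using eventually_happens'[OF sequentially_bot eventually_conj[OF 1 2]] by blast
  have "C * \<epsilon> \<le> (C + 1) * \<epsilon>"
    using \<epsilon> by (intro mult_right_mono) auto
  also have "\<dots> = e / 4"
    unfolding \<epsilon>_def by (subst times_divide_eq_right, rule nonzero_mult_div_cancel_left) (use C in simp)
  finally have "C * \<epsilon> \<le> e / 4" .
  then have near: "vdist X (approx n x) (approx N x) < e / 2" if "N \<le> n" for n
  proof -
    have "vdist X (approx n x) (approx N x) \<le> C * \<epsilon> + M * exp (- \<delta> * N) * (C * vnorm X x)"
      unfolding C_def by (rule vdist_approx_le[OF x that], rule d(2)) (use N(1) in linarith)+
    with N(2) \<open>C * \<epsilon> \<le> e / 4\<close> show ?thesis
      by linarith
  qed
  show "\<exists>N. \<forall>n n'. N \<le> n \<longrightarrow> N \<le> n' \<longrightarrow> vdist X (approx n x) (approx n' x) < e"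
  proof (intro exI[of _ N] allI impI)
    fix n n' assume "N \<le> n" "N \<le> n'"
    then show "vdist X (approx n x) (approx n' x) < e"
      using near[of n] near[of n'] x metric.triangle[of "approx n x" "approx N x" "approx n' x"]
        metric.commute[of "approx N x" "approx n' x"] by fastforce
  qed
qed

section \<open>The integral of the orbit as inverse of the negative generator\<close>

definition lap :: "'a \<Rightarrow> 'a" where
  "lap x = (THE y. limitin (norm_topology X) (\<lambda>n. approx n x) y sequentially)"

lemma approx_limitin:
  assumes "x \<in> carrier X"
  shows "limitin (norm_topology X) (\<lambda>n. approx n x) (lap x) sequentially"
proof -
  obtain y where y: "limitin (norm_topology X) (\<lambda>n. approx n x) y sequentially"
    using complete[unfolded metric.mcomplete_def, rule_format, OF approx_MCauchy[OF assms]]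
    unfolding norm_topology_def ..
  show ?thesis
    unfolding lap_def by (rule theI, rule y, erule limitin_norm_unique[OF _ y]) simp
qed

lemma lap_closed [simp, intro]: "x \<in> carrier X \<Longrightarrow> lap x \<in> carrier X"
  using approx_limitin[of x] by (simp add: limitin_norm_iff)

lemma bounded_operator_lap: "bounded_operator X lap"
proof -
  have "lap (x \<oplus> y) = lap x \<oplus> lap y" if "x \<in> carrier X" "y \<in> carrier X" for x y
  proof (rule limitin_norm_unique)
    show "limitin (norm_topology X) (\<lambda>n. approx n (x \<oplus> y)) (lap (x \<oplus> y)) sequentially"
      using that by (intro approx_limitin) auto
    show "limitin (norm_topology X) (\<lambda>n. approx n (x \<oplus> y)) (lap x \<oplus> lap y) sequentially"
      using limitin_norm_add[OF approx_limitin approx_limitin] that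
      by (simp add: bounded_operator_add[OF bounded_operator_approx])
  qed auto
  moreover have "lap (c \<odot> x) = c \<odot> lap x" if "x \<in> carrier X" for c x
  proof (rule limitin_norm_unique)
    show "limitin (norm_topology X) (\<lambda>n. approx n (c \<odot> x)) (lap (c \<odot> x)) sequentially"
      using that by (intro approx_limitin) auto
    show "limitin (norm_topology X) (\<lambda>n. approx n (c \<odot> x)) (c \<odot> lap x) sequentially"
      using limitin_norm_smult[OF tendsto_const approx_limitin] that
      by (simp add: bounded_operator_smult[OF bounded_operator_approx])
  qed auto
  moreover have "vnorm X (lap x) \<le> M * (1 / \<delta> + 1) * vnorm X x" if "x \<in> carrier X" for x
  proof (rule LIMSEQ_le_const2)
    \<comment> \<open>The norm is written as the distance to zero so that continuity of the distance
      applies.\<close>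
    show "(\<lambda>n. vdist X (approx n x) \<zero>) \<longlonglongrightarrow> vnorm X (lap x)"
      using that tendsto_vdist[OF approx_limitin limitin_norm_const, of x \<zero>]
      by (simp add: vdist_zero)
    show "\<exists>N. \<forall>n\<ge>N. vdist X (approx n x) \<zero> \<le> M * (1 / \<delta> + 1) * vnorm X x"
      using that vnorm_approx_le by (simp add: vdist_zero)
  qed
  ultimately show ?thesis
    by (auto simp: bounded_operator_def intro!: exI[of _ "M * (1 / \<delta> + 1)"])
qed

text \<open>Approximate form of
  \<open>S h (lap x) + (integral of S t x over [0, h]) = lap x\<close>, with the integral replaced
  by \<open>h\<close> times \<open>x\<close>. A dyadic \<open>h\<close> is a whole number of steps
  in every sufficiently fine mesh.\<close>

lemma vdist_S_lap_le_dyadic: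
  assumes x: "x \<in> carrier X" and h: "h = real m / 2 ^ p"
    and near: "\<And>t. 0 \<le> t \<Longrightarrow> t \<le> h \<Longrightarrow> vdist X (S t x) x \<le> \<epsilon>"
  shows "vdist X (S h (lap x) \<oplus> complex_of_real h \<odot> x) (lap x) \<le> h * \<epsilon>"
proof (rule LIMSEQ_le)
  have h0: "h \<ge> 0"
    using h by simp
  show "(\<lambda>n. vdist X (S h (approx n x) \<oplus> complex_of_real h \<odot> x) (approx n x)) \<longlonglongrightarrow>
      vdist X (S h (lap x) \<oplus> complex_of_real h \<odot> x) (lap x)"
    using x h0 by (intro tendsto_vdist limitin_norm_add limitin_norm_const approx_limitin
        limitin_bounded_operator[OF C0_semigroup_bounded[OF C0]]) auto
  define c where "c = M * (1 / \<delta> + 1) * vnorm X x"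
  have "(\<lambda>n::nat. exp (- \<delta> * n)) \<longlonglongrightarrow> 0"
    using \<delta>_pos by real_asymp
  then have "(\<lambda>n::nat. h * \<epsilon> + M * exp (- \<delta> * n) * c) \<longlonglongrightarrow> h * \<epsilon> + M * 0 * c"
    by (intro tendsto_intros)
  then show "(\<lambda>n::nat. h * \<epsilon> + M * exp (- \<delta> * n) * c) \<longlonglongrightarrow> h * \<epsilon>"
    by simp
  show "\<exists>N. \<forall>n\<ge>N. vdist X (S h (approx n x) \<oplus> complex_of_real h \<odot> x) (approx n x) \<le>
      h * \<epsilon> + M * exp (- \<delta> * n) * c"
  proof (intro exI[of _ p] allI impI)
    fix n assume n: "p \<le> n"
    define \<eta> :: real where "\<eta> = 1 / 2 ^ n"
    define K where "K = m * 2 ^ (n - p)"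
    have \<eta>: "0 < \<eta>" "\<eta> \<le> 1"
      by (simp_all add: \<eta>_def)
    have "real K * \<eta> = real m * (2 ^ (n - p) / 2 ^ n)"
      by (simp add: K_def \<eta>_def)
    also have "(2::real) ^ (n - p) / 2 ^ n = 1 / 2 ^ p"
      using n by (simp add: power_diff)
    finally have Kh: "real K * \<eta> = h"
      using h by simp
    have time: "real (n * 2 ^ n) * \<eta> = real n"
      by (simp add: \<eta>_def)
    \<comment> \<open>One sum over \<open>[0, h + n]\<close> is split at time \<open>h\<close> and
      at time \<open>n\<close>. Equating the two splittings gives the shift identity for
      \<open>approx n x\<close> up to a term shifted by time \<open>n\<close>, which decays.\<close>
    have 1: "rs \<eta> (K + n * 2 ^ n) x = rs \<eta> K x \<oplus> S h (approx n x)"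
      using rs_add[of \<eta> x K "n * 2 ^ n"] \<eta> x by (simp add: Kh approx_def \<eta>_def[symmetric])
    have 2: "rs \<eta> (K + n * 2 ^ n) x = approx n x \<oplus> S n (rs \<eta> K x)"
      using rs_add[of \<eta> x "n * 2 ^ n" K] \<eta> x
      by (simp only: time approx_def \<eta>_def[symmetric] add.commute less_imp_le)
    have eq: "S h (approx n x) \<oplus> rs \<eta> K x = approx n x \<oplus> S n (rs \<eta> K x)"
      using 1 2 x \<eta> h0 by (simp add: M.a_comm)
    let ?l = "S h (approx n x) \<oplus> complex_of_real h \<odot> x"
    have "vdist X ?l (approx n x) \<le>
        vdist X ?l (S h (approx n x) \<oplus> rs \<eta> K x) + vdist X (approx n x \<oplus> S n (rs \<eta> K x)) (approx n x)"
      using metric.triangle[of ?l "S h (approx n x) \<oplus> rs \<eta> K x" "approx n x"] x h0 \<eta>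
      by (simp add: eq)
    also have "vdist X ?l (S h (approx n x) \<oplus> rs \<eta> K x) = vdist X (rs \<eta> K x) (complex_of_real (real K * \<eta>) \<odot> x)"
      using x h0 \<eta> by (simp add: vdist_add_left Kh metric.commute del: of_real_mult)
    also have "\<dots> \<le> real K * \<eta> * \<epsilon>"
      using x \<eta> near by (intro vdist_rs_vsmult_le) (auto simp: Kh)
    also have "vdist X (approx n x \<oplus> S n (rs \<eta> K x)) (approx n x) = vnorm X (S n (rs \<eta> K x))"
      using x \<eta> by (simp add: vdist_add_self)
    also have "\<dots> \<le> M * exp (- \<delta> * n) * c"
      unfolding c_def using x \<eta> by (intro vnorm_S_rs_le) auto
    finally show "vdist X ?l (approx n x) \<le> h * \<epsilon> + M * exp (- \<delta> * n) * c"
      by (simp add: Kh)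
  qed
qed

text \<open>Both sides are continuous in \<open>h\<close>, so the dyadic case suffices.\<close>

lemma vdist_S_lap_le:
  assumes x: "x \<in> carrier X" and h: "h \<ge> 0"
    and near: "\<And>t. 0 \<le> t \<Longrightarrow> t \<le> h \<Longrightarrow> vdist X (S t x) x \<le> \<epsilon>"
  shows "vdist X (S h (lap x) \<oplus> complex_of_real h \<odot> x) (lap x) \<le> h * \<epsilon>"
proof (rule LIMSEQ_le)
  \<comment> \<open>Dyadic approximation from below: the closeness assumed on \<open>[0, h]\<close>
    then holds on \<open>[0, q n]\<close>.\<close>
  define q where "q n = real (nat \<lfloor>h * 2 ^ n\<rfloor>) / 2 ^ n" for n :: nat
  have q_le: "q n \<le> h" and q_ge: "q n \<ge> h - 1 / 2 ^ n" and q0: "q n \<ge> 0" for n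
  proof -
    have "real (nat \<lfloor>h * 2 ^ n\<rfloor>) = of_int \<lfloor>h * 2 ^ n\<rfloor>"
      using h by simp
    moreover have "of_int \<lfloor>h * 2 ^ n\<rfloor> \<le> h * 2 ^ n" "of_int \<lfloor>h * 2 ^ n\<rfloor> \<ge> h * 2 ^ n - 1"
      by linarith+
    moreover have "h - 1 / 2 ^ n = (h * 2 ^ n - 1) / 2 ^ n"
      by (simp add: diff_divide_distrib)
    ultimately show "q n \<le> h" "q n \<ge> h - 1 / 2 ^ n"
      by (simp_all add: q_def divide_right_mono divide_le_eq)
    show "q n \<ge> 0"
      by (simp add: q_def)
  qed
  have q: "q \<longlonglongrightarrow> h"
  proof (rule tendsto_sandwich)
    show "(\<lambda>n. h - 1 / 2 ^ n) \<longlonglongrightarrow> h"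
      by real_asymp
    show "(\<lambda>n::nat. h) \<longlonglongrightarrow> h"
      by simp
  qed (use q_le q_ge in auto)
  show "(\<lambda>n. vdist X (S (q n) (lap x) \<oplus> complex_of_real (q n) \<odot> x) (lap x)) \<longlonglongrightarrow>
      vdist X (S h (lap x) \<oplus> complex_of_real h \<odot> x) (lap x)"
    using x h q q0
    by (intro tendsto_vdist limitin_norm_add limitin_norm_const limitin_norm_smult
        C0_semigroup_limitin[OF C0] tendsto_of_real) auto
  show "(\<lambda>n. q n * \<epsilon>) \<longlonglongrightarrow> h * \<epsilon>"
    by (intro tendsto_intros q)
  show "\<exists>N. \<forall>n\<ge>N. vdist X (S (q n) (lap x) \<oplus> complex_of_real (q n) \<odot> x) (lap x) \<le> q n * \<epsilon>"
  proof (intro exI[of _ 0] allI impI)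
    fix n
    show "vdist X (S (q n) (lap x) \<oplus> complex_of_real (q n) \<odot> x) (lap x) \<le> q n * \<epsilon>"
      by (rule vdist_S_lap_le_dyadic[OF x q_def]) (use near q_le[of n] in auto)
  qed
qed

text \<open>After division by \<open>t\<close> the approximate shift identity leaves an error
  \<open>\<epsilon>\<close> that is arbitrarily small near time 0. The sign is that of the
  derivative of an integral in its lower limit.\<close>

lemma generates_at_lap:
  assumes x: "x \<in> carrier X"
  shows "generates_at X S (lap x) (\<ominus> x)"
proof -
  have key: "vdist X (complex_of_real (1 / t) \<odot> (S t (lap x) \<ominus> lap x)) (\<ominus> x) =
      1 / t * vdist X (S t (lap x) \<oplus> complex_of_real t \<odot> x) (lap x)" if "t > 0" for t
  proof -
    let ?a = "S t (lap x)" and ?b = "lap x" and ?c = "complex_of_real t \<odot> x"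
    have car: "?a \<in> carrier X" "?b \<in> carrier X" "?c \<in> carrier X"
      using x that by auto
    have "\<ominus> x = complex_of_real (1 / t) \<odot> (\<ominus> ?c)"
      using that x by (simp add: vsmult_r_minus flip: vsmult_assoc)
    then have "vdist X (complex_of_real (1 / t) \<odot> (?a \<ominus> ?b)) (\<ominus> x) =
        1 / t * vdist X (?a \<ominus> ?b) (\<ominus> ?c)"
      using that car by (simp add: vdist_smult norm_divide)
    also have "vdist X (?a \<ominus> ?b) (\<ominus> ?c) = vdist X (?a \<oplus> ?c) ?b"
    proof -
      have "(?a \<ominus> ?b) \<ominus> (\<ominus> ?c) = (?a \<oplus> ?c) \<ominus> ?b"
        using car by (simp add: M.minus_eq M.a_ac)
      then show ?thesis
        using car by (simp add: vdist_eq)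
    qed
    finally show ?thesis .
  qed
  have "((\<lambda>t. vdist X (complex_of_real (1 / t) \<odot> (S t (lap x) \<ominus> lap x)) (\<ominus> x)) \<longlongrightarrow> 0) (at_right 0)"
  proof (rule tendstoI)
    fix e :: real assume "e > 0"
    then obtain d where d: "d > 0" "\<And>t. 0 \<le> t \<Longrightarrow> t \<le> d \<Longrightarrow> vdist X (S t x) x \<le> e / 2"
      using orbit_near_zero[OF x, of "e / 2"] by (metis half_gt_zero)
    have "vdist X (complex_of_real (1 / t) \<odot> (S t (lap x) \<ominus> lap x)) (\<ominus> x) < e"
      if "0 < t" "t < d" for t
    proof -
      have "vdist X (S t (lap x) \<oplus> complex_of_real t \<odot> x) (lap x) \<le> t * (e / 2)"
        using that d(2) by (intro vdist_S_lap_le x) auto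
      then have "1 / t * vdist X (S t (lap x) \<oplus> complex_of_real t \<odot> x) (lap x) \<le> e / 2"
        using that by (simp add: field_simps)
      then show ?thesis
        using key[OF that(1)] \<open>e > 0\<close> by linarith
    qed
    then show "\<forall>\<^sub>F t in at_right 0.
        dist (vdist X (complex_of_real (1 / t) \<odot> (S t (lap x) \<ominus> lap x)) (\<ominus> x)) 0 < e"
      using d(1) by (auto simp: eventually_at_right_field)
  qed
  moreover have "\<forall>\<^sub>F t in at_right 0. complex_of_real (1 / t) \<odot> (S t (lap x) \<ominus> lap x) \<in> carrier X"
    using eventually_at_right_less[of "0::real"] by eventually_elim (use x in auto)
  ultimately show ?thesis
    using x by (simp add: generates_at_def limitin_norm_iff)
qed

lemma S_approx_commute:
  assumes "x \<in> carrier X" "t \<ge> 0"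
  shows "S t (approx n x) = approx n (S t x)"
proof -
  have "S t (S s x) = S s (S t x)" if "s \<ge> 0" for s
    using assms that C0_semigroup_add[OF C0, of t s x] C0_semigroup_add[OF C0, of s t x]
    by (simp add: add.commute)
  then show ?thesis
    using assms C0_semigroup_bounded[OF C0, of t]
    by (simp add: approx_def riemann_sum_def bounded_operator_smult bounded_operator_finsum orbit_Pi)
qed

lemma S_lap_commute:
  assumes "x \<in> carrier X" "t \<ge> 0"
  shows "S t (lap x) = lap (S t x)"
proof (rule limitin_norm_unique)
  show "limitin (norm_topology X) (\<lambda>n. S t (approx n x)) (S t (lap x)) sequentially"
    using assms by (intro limitin_bounded_operator[OF C0_semigroup_bounded[OF C0]] approx_limitin)
  show "limitin (norm_topology X) (\<lambda>n. S t (approx n x)) (lap (S t x)) sequentially"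
    using assms approx_limitin[of "S t x"] by (simp add: S_approx_commute)
qed auto

text \<open>Apply the bounded operator \<open>lap\<close> to the difference quotients at
  \<open>x\<close>. As it commutes with the semigroup, they become the quotients at
  \<open>lap x\<close>, whose limit is known to be \<open>- x\<close>.\<close>

lemma lap_generates_at:
  assumes x: "x \<in> carrier X" and gen: "generates_at X S x y"
  shows "lap y = \<ominus> x"
proof (rule limitin_norm_unique)
  let ?q = "\<lambda>x t. complex_of_real (1 / t) \<odot> (S t x \<ominus> x)"
  show "limitin (norm_topology X) (\<lambda>t. lap (?q x t)) (lap y) (at_right 0)"
    using gen limitin_bounded_operator[OF bounded_operator_lap] by (simp add: generates_at_def)
  have "\<forall>\<^sub>F t in at_right 0. ?q (lap x) t = lap (?q x t)"
    using eventually_at_right_less[of "0::real"]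
    by eventually_elim (use x bounded_operator_lap in
      \<open>simp add: bounded_operator_smult bounded_operator_minus S_lap_commute\<close>)
  then show "limitin (norm_topology X) (\<lambda>t. lap (?q x t)) (\<ominus> x) (at_right 0)"
    using generates_at_lap[OF x] unfolding generates_at_def
    by (rule limitin_transform_eventually)
qed auto

end

section \<open>Resolvents of generators\<close>

text \<open>Resolvents and generators are given by descriptions and agree with explicit operators
  only on the carrier; boundedness is transferred along this agreement.\<close>

lemma bounded_operator_cong:
  assumes "bounded_operator X B" "\<And>x. x \<in> carrier X \<Longrightarrow> B' x = B x"
    and "\<And>x y. x \<in> carrier X \<Longrightarrow> y \<in> carrier X \<Longrightarrow> x \<oplus>\<^bsub>X\<^esub> y \<in> carrier X"
    and "\<And>c x. x \<in> carrier X \<Longrightarrow> c \<odot>\<^bsub>X\<^esub> x \<in> carrier X"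
  shows "bounded_operator X B'"
  using assms by (simp add: bounded_operator_def Pi_iff)

lemma continuous_map_atLeast_zeroI:
  fixes f :: "real \<Rightarrow> 'a"
  assumes "\<And>s. s \<ge> 0 \<Longrightarrow> limitin Y f (f s) (at s within {0..})"
  shows "continuous_map (top_of_set {0..}) Y f"
proof -
  have "atin_within euclidean s {0..} = at s within {0..}" for s :: real
    by (auto simp: filter_eq_iff eventually_atin_within eventually_at_topological)
  with assms show ?thesis
    by (auto simp: continuous_map_atin atin_subtopology_within)
qed

lemma tendsto_exp_difference_quotient:
  fixes z :: complex
  shows "((\<lambda>t. (exp (- z * complex_of_real t) - 1) / complex_of_real t) \<longlongrightarrow> - z) (at_right 0)"
proof -
  have "((\<lambda>w. exp (- z * w)) has_field_derivative - z) (at 0)"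
    by (auto intro!: derivative_eq_intros)
  then have "((\<lambda>w. (exp (- z * w) - 1) / w) \<longlongrightarrow> - z) (at 0)"
    by (simp add: DERIV_def)
  moreover have "filterlim complex_of_real (at 0) (at_right 0)"
    by (rule filterlim_atI)
      (auto intro!: tendsto_eq_intros eventually_mono[OF eventually_at_right_less[of "0::real"]])
  ultimately show ?thesis
    by (rule filterlim_compose)
qed

text \<open>The generator of the rescaled semigroup is \<open>A - z\<close>, so the inverse of its
  negative is the resolvent of \<open>A\<close> at \<open>z\<close>.\<close>

definition rescale ::
    "'a normed_module \<Rightarrow> complex \<Rightarrow> (real \<Rightarrow> 'a \<Rightarrow> 'a) \<Rightarrow> real \<Rightarrow> 'a \<Rightarrow> 'a" where
  "rescale X z T t x = exp (- z * complex_of_real t) \<odot>\<^bsub>X\<^esub> T t x"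

section \<open>Generators under rescaling\<close>

context complex_normed_space
begin

lemma C0_semigroup_rescale:
  assumes T: "C0_semigroup X T"
  shows "C0_semigroup X (rescale X z T)"
  unfolding C0_semigroup_def
proof (intro conjI allI ballI impI)
  fix t :: real assume t: "0 \<le> t"
  note B = C0_semigroup_bounded[OF T t]
  obtain C where C: "C \<ge> 0" "\<And>x. x \<in> carrier X \<Longrightarrow> vnorm X (T t x) \<le> C * vnorm X x"
    using bounded_operator_bound[OF B] by blast
  let ?e = "exp (- z * complex_of_real t)"
  have "vnorm X (?e \<odot> T t x) \<le> cmod ?e * C * vnorm X x" if "x \<in> carrier X" for x
    using that C(2)[OF that] mult_left_mono[OF C(2)[OF that], of "cmod ?e"]
    by (simp add: vnorm_smult bounded_operator_closed[OF B] mult.assoc)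
  moreover have "?e \<odot> (c \<odot> T t x) = c \<odot> (?e \<odot> T t x)" if "x \<in> carrier X" for c x
    using that by (simp add: bounded_operator_closed[OF B] mult.commute flip: vsmult_assoc)
  ultimately show "bounded_operator X (rescale X z T t)"
    unfolding bounded_operator_def rescale_def
    using bounded_operator_closed[OF B]
    by (auto simp: bounded_operator_add[OF B] bounded_operator_smult[OF B] vsmult_r_distr
        intro!: exI[of _ "cmod ?e * C"])
next
  fix x assume "x \<in> carrier X"
  then show "rescale X z T 0 x = x"
    by (simp add: rescale_def C0_semigroup_zero[OF T])
next
  fix s t :: real and x assume "0 \<le> s" "0 \<le> t" "x \<in> carrier X"
  then show "rescale X z T (s + t) x = rescale X z T s (rescale X z T t x)"
    by (simp add: rescale_def C0_semigroup_add[OF T] C0_semigroup_closed[OF T]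
        bounded_operator_smult[OF C0_semigroup_bounded[OF T]] exp_add exp_diff exp_minus ring_distribs divide_inverse
        flip: vsmult_assoc)
next
  fix x assume x: "x \<in> carrier X"
  have "limitin (norm_topology X) (\<lambda>t. rescale X z T t x) (rescale X z T s x) (at s within {0..})"
    if "s \<ge> 0" for s
  proof -
    have "\<forall>\<^sub>F t in at s within {0..}. t \<ge> 0"
      by (auto simp: eventually_at_filter)
    then show ?thesis
      unfolding rescale_def using x that
      by (intro limitin_norm_smult C0_semigroup_limitin[OF T]) (auto intro!: tendsto_intros)
  qed
  then show "continuous_map (top_of_set {0..}) (norm_topology X) (\<lambda>t. rescale X z T t x)"
    by (rule continuous_map_atLeast_zeroI)
qed

lemma generates_at_rescale:
  assumes T: "C0_semigroup X T" and x: "x \<in> carrier X" and gen: "generates_at X T x y"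
  shows "generates_at X (rescale X z T) x (y \<ominus> z \<odot> x)"
proof -
  let ?e = "\<lambda>t. exp (- z * complex_of_real t)"
  have y: "y \<in> carrier X"
    using gen by (auto simp: generates_at_def limitin_norm_iff)
  have "((\<lambda>t. ?e t) \<longlongrightarrow> ?e 0) (at_right 0)"
    by (intro tendsto_intros)
  \<comment> \<open>The product rule: \<open>e T x - x = e (T x - x) + (e - 1) x\<close> with
    \<open>e = exp (- z * t)\<close>, divided by \<open>t\<close>.\<close>
  then have "limitin (norm_topology X)
      (\<lambda>t. ?e t \<odot> (complex_of_real (1 / t) \<odot> (T t x \<ominus> x)) \<oplus> ((?e t - 1) / complex_of_real t) \<odot> x)
      (?e 0 \<odot> y \<oplus> (- z) \<odot> x) (at_right 0)"
    using gen x unfolding generates_at_def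
    by (intro limitin_norm_add limitin_norm_smult limitin_norm_const tendsto_exp_difference_quotient) auto
  moreover have "?e 0 \<odot> y \<oplus> (- z) \<odot> x = y \<ominus> z \<odot> x"
    using x y by (simp add: M.minus_eq vsmult_l_minus)
  moreover have "\<forall>\<^sub>F t in at_right 0.
      ?e t \<odot> (complex_of_real (1 / t) \<odot> (T t x \<ominus> x)) \<oplus> ((?e t - 1) / complex_of_real t) \<odot> x =
      complex_of_real (1 / t) \<odot> (rescale X z T t x \<ominus> x)"
    using eventually_at_right_less[of "0::real"]
  proof eventually_elim
    case (elim t)
    define c where "c = complex_of_real (1 / t)"
    define u where "u = T t x"
    have u: "u \<in> carrier X"
      using elim x by (auto simp: u_def intro: C0_semigroup_closed[OF T])
    have "?e t \<odot> (c \<odot> (u \<ominus> x)) \<oplus> (c * (?e t - 1)) \<odot> x =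
        c \<odot> (?e t \<odot> (u \<ominus> x) \<oplus> (?e t - 1) \<odot> x)"
      using u x by (simp add: vsmult_r_distr mult.commute flip: vsmult_assoc)
    also have "?e t \<odot> (u \<ominus> x) \<oplus> (?e t - 1) \<odot> x = ?e t \<odot> u \<ominus> x"
      using u x
      by (simp add: vsmult_r_minus_distr vsmult_l_minus_distr vminus_add_vminus)
    finally show ?case
      by (simp add: c_def u_def rescale_def)
  qed
  ultimately show ?thesis
    unfolding generates_at_def by (auto intro: limitin_transform_eventually)
qed

text \<open>Rescaling by \<open>- z\<close> undoes rescaling by \<open>z\<close>, so the converse is
  an instance of the forward direction.\<close>

lemma generates_at_rescale_imp:
  assumes T: "C0_semigroup X T" and x: "x \<in> carrier X" and gen: "generates_at X (rescale X z T) x y"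
  shows "generates_at X T x (y \<oplus> z \<odot> x)"
proof -
  have y: "y \<in> carrier X"
    using gen by (auto simp: generates_at_def limitin_norm_iff)
  have "rescale X (- z) (rescale X z T) t x = T t x" if "t > 0" for t
    using x that
    by (simp add: rescale_def C0_semigroup_closed[OF T] flip: vsmult_assoc exp_add)
  then have "\<forall>\<^sub>F t in at_right 0.
      complex_of_real (1 / t) \<odot> (rescale X (- z) (rescale X z T) t x \<ominus> x) =
      complex_of_real (1 / t) \<odot> (T t x \<ominus> x)"
    by (intro eventually_mono[OF eventually_at_right_less[of "0::real"]]) simp
  moreover have "generates_at X (rescale X (- z) (rescale X z T)) x (y \<ominus> (- z) \<odot> x)"
    by (intro generates_at_rescale C0_semigroup_rescale T x gen)
  moreover have "y \<ominus> (- z) \<odot> x = y \<oplus> z \<odot> x"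
    using x y by (simp add: M.minus_eq vsmult_l_minus)
  ultimately show ?thesis
    unfolding generates_at_def by (auto intro: limitin_transform_eventually)
qed

lemma generates_at_unique: "generates_at X T x y \<Longrightarrow> generates_at X T x y' \<Longrightarrow> y = y'"
  unfolding generates_at_def by (erule limitin_norm_unique) auto

lemma opfun_generator: "generates_at X T x y \<Longrightarrow> opfun (generator X T) x = y"
  by (auto simp: generator_def intro: the_equality generates_at_unique)

lemma opdom_generator: "x \<in> opdom (generator X T) \<longleftrightarrow> x \<in> carrier X \<and> (\<exists>y. generates_at X T x y)"
  by (simp add: generator_def)

lemma generator_generates_at:
  "x \<in> opdom (generator X T) \<Longrightarrow> generates_at X T x (opfun (generator X T) x)"
  by (metis opdom_generator opfun_generator)

lemma opfun_generator_closed: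
  "x \<in> opdom (generator X T) \<Longrightarrow> opfun (generator X T) x \<in> carrier X"
  using generator_generates_at[of x T] by (simp add: generates_at_def limitin_norm_iff)

end

section \<open>Resolvents to the right of the growth bound\<close>

context complex_banach_space
begin

context
  fixes T M \<omega>
  assumes T: "C0_semigroup X T" and M: "M \<ge> 1"
    and growth: "\<And>t. t \<ge> 0 \<Longrightarrow> operator_norm X (T t) \<le> M * exp (\<omega> * t)"
begin

lemma vnorm_semigroup_le:
  assumes "t \<ge> 0" "x \<in> carrier X"
  shows "vnorm X (T t x) \<le> M * exp (\<omega> * t) * vnorm X x"
  by (rule order_trans[OF norm_le_operator_norm mult_right_mono])
    (use assms growth vnorm_nonneg C0_semigroup_bounded[OF T] in auto)

context
  fixes z assumes z: "Re z > \<omega>"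
begin

lemma decaying_semigroup_rescale: "decaying_semigroup X (rescale X z T) M (Re z - \<omega>)"
proof (unfold_locales)
  show "C0_semigroup X (rescale X z T)"
    by (rule C0_semigroup_rescale[OF T])
  fix t x assume *: "(0::real) \<le> t" "x \<in> carrier X"
  have "vnorm X (rescale X z T t x) = exp (- Re z * t) * vnorm X (T t x)"
    using * by (simp add: rescale_def vnorm_smult C0_semigroup_closed[OF T] norm_exp_eq_Re)
  also have "\<dots> \<le> exp (- Re z * t) * (M * exp (\<omega> * t) * vnorm X x)"
    using * by (intro mult_left_mono vnorm_semigroup_le) auto
  also have "\<dots> = M * exp (- (Re z - \<omega>) * t) * vnorm X x"
    by (simp add: exp_minus exp_diff left_diff_distrib field_simps)
  finally show "vnorm X (rescale X z T t x) \<le> M * exp (- (Re z - \<omega>) * t) * vnorm X x" .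
qed (use M z in auto)

interpretation S: decaying_semigroup X "rescale X z T" M "Re z - \<omega>"
  by (rule decaying_semigroup_rescale)

lemma generates_at_lap_rescale:
  assumes "x \<in> carrier X"
  shows "generates_at X T (S.lap x) (\<ominus> x \<oplus> z \<odot> S.lap x)"
  using assms by (intro generates_at_rescale_imp[OF T] S.generates_at_lap) auto

lemma lap_in_generator_domain: "x \<in> carrier X \<Longrightarrow> S.lap x \<in> opdom (generator X T)"
  using generates_at_lap_rescale by (auto simp: opdom_generator)

lemma generator_lap:
  assumes "x \<in> carrier X"
  shows "z \<odot> S.lap x \<ominus> opfun (generator X T) (S.lap x) = x"
proof -
  let ?a = "z \<odot> S.lap x"
  have "?a \<ominus> (\<ominus> x \<oplus> ?a) = x \<oplus> (?a \<ominus> ?a)"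
    using assms by (simp only: M.minus_eq M.minus_add M.minus_minus M.a_ac M.a_inv_closed M.a_closed
        vsmult_closed S.lap_closed)
  also have "\<dots> = x"
    using assms by simp
  finally have "?a \<ominus> (\<ominus> x \<oplus> ?a) = x" .
  then show ?thesis
    by (simp add: opfun_generator[OF generates_at_lap_rescale[OF assms]])
qed

lemma lap_generator:
  assumes x: "x \<in> opdom (generator X T)"
  shows "S.lap (z \<odot> x \<ominus> opfun (generator X T) x) = x"
proof -
  let ?y = "opfun (generator X T) x"
  have car: "x \<in> carrier X" "?y \<in> carrier X"
    using x opfun_generator_closed by (auto simp: opdom_generator)
  have "S.lap (?y \<ominus> z \<odot> x) = \<ominus> x"
    by (intro S.lap_generates_at generates_at_rescale[OF T] generator_generates_at car x)
  moreover have "S.lap (z \<odot> x \<ominus> ?y) = S.lap (z \<odot> x) \<ominus> S.lap ?y"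
    and "S.lap (?y \<ominus> z \<odot> x) = S.lap ?y \<ominus> S.lap (z \<odot> x)"
    using car by (auto intro!: bounded_operator_minus S.bounded_operator_lap)
  moreover have "\<ominus> (S.lap ?y \<ominus> S.lap (z \<odot> x)) = S.lap (z \<odot> x) \<ominus> S.lap ?y"
    using car by (simp add: M.minus_eq M.minus_add M.a_comm)
  ultimately show ?thesis
    using car M.minus_minus by metis
qed

lemma bij_betw_generator:
  "bij_betw (\<lambda>x. z \<odot> x \<ominus> opfun (generator X T) x) (opdom (generator X T)) (carrier X)"
proof (rule bij_betw_byWitness[where f' = S.lap])
  show "(\<lambda>x. z \<odot> x \<ominus> opfun (generator X T) x) ` opdom (generator X T) \<subseteq> carrier X"
    using opfun_generator_closed by (auto simp: opdom_generator)
qed (use lap_generator generator_lap lap_in_generator_domain in auto)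

lemma resolvent_eq_lap:
  assumes "x \<in> carrier X"
  shows "resolvent X z (generator X T) x = S.lap x"
  unfolding resolvent_def using bij_betw_generator assms
  by (intro the_inv_into_f_eq generator_lap lap_in_generator_domain) (auto simp: bij_betw_def)

lemma in_resolvent_set: "z \<in> resolvent_set X (generator X T)"
  using bij_betw_generator bounded_operator_cong[OF S.bounded_operator_lap resolvent_eq_lap]
  by (auto simp: resolvent_set_def)

lemma resolvent_generator:
  assumes "x \<in> opdom (generator X T)"
  shows "resolvent X z (generator X T) (z \<odot> x \<ominus> opfun (generator X T) x) = x"
  using assms lap_generator opfun_generator_closed by (simp add: resolvent_eq_lap opdom_generator)

lemma resolvent_in_generator_domain:
  "x \<in> carrier X \<Longrightarrow> resolvent X z (generator X T) x \<in> opdom (generator X T)"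
  by (simp add: resolvent_eq_lap lap_in_generator_domain)

lemma opfun_generator_resolvent:
  assumes "x \<in> carrier X"
  shows "opfun (generator X T) (resolvent X z (generator X T) x) =
    z \<odot> resolvent X z (generator X T) x \<ominus> x"
proof -
  have "\<ominus> x \<oplus> z \<odot> S.lap x = z \<odot> S.lap x \<ominus> x"
    using assms by (simp add: M.minus_eq M.a_comm)
  then show ?thesis
    using assms by (simp add: resolvent_eq_lap opfun_generator[OF generates_at_lap_rescale])
qed

end

end

text \<open>The Riemann sums of both semigroups use the same grid and are compared under
  \<open>\<phi>\<close> term by term. The geometric series bounds the difference independently of
  the index, so the bound passes to the limit.\<close>

lemma lap_dual_diff_le:
  assumes "decaying_semigroup X S M \<delta>" "decaying_semigroup X S' M' \<delta>'"
    and \<phi>: "\<phi> \<in> dual_space X" and x: "x \<in> carrier X" and "a > 0" "\<epsilon> \<ge> 0"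
    and diff: "\<And>t. t \<ge> 0 \<Longrightarrow> cmod (\<phi> (S t x) - \<phi> (S' t x)) \<le> \<epsilon> * exp (- a * t)"
  shows "cmod (\<phi> (decaying_semigroup.lap X S x) - \<phi> (decaying_semigroup.lap X S' x)) \<le> \<epsilon> * (1 / a + 1)"
proof -
  interpret S: decaying_semigroup X S M \<delta> by fact
  interpret S': decaying_semigroup X S' M' \<delta>' by fact
  show ?thesis
  proof (rule LIMSEQ_le_const2)
    show "(\<lambda>n. cmod (\<phi> (S.approx n x) - \<phi> (S'.approx n x))) \<longlonglongrightarrow> cmod (\<phi> (S.lap x) - \<phi> (S'.lap x))"
      by (intro tendsto_intros tendsto_dual[OF \<phi>] S.approx_limitin S'.approx_limitin x)
    have "cmod (\<phi> (S.approx n x) - \<phi> (S'.approx n x)) \<le> \<epsilon> * (1 / a + 1)" for n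
    proof -
      define h :: real where "h = 1 / 2 ^ n"
      have h: "0 < h" "h \<le> 1"
        by (simp_all add: h_def)
      have "\<phi> (S.approx n x) - \<phi> (S'.approx n x) =
          h * (\<Sum>k<n * 2 ^ n. \<phi> (S (real k * h) x) - \<phi> (S' (real k * h) x))"
        using h x \<phi>
        by (simp add: S.approx_def S'.approx_def riemann_sum_def h_def[symmetric] dual_smult dual_finsum
            S.orbit_Pi S'.orbit_Pi sum_subtractf right_diff_distrib)
      then have "cmod (\<phi> (S.approx n x) - \<phi> (S'.approx n x)) =
          h * cmod (\<Sum>k<n * 2 ^ n. \<phi> (S (real k * h) x) - \<phi> (S' (real k * h) x))"
        using h by (simp add: norm_mult)
      also have "\<dots> \<le> h * (\<Sum>k<n * 2 ^ n. \<epsilon> * exp (- a * (real k * h)))"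
        using h by (intro mult_left_mono sum_norm_le diff) auto
      also have "\<dots> = \<epsilon> * (h * (\<Sum>k<n * 2 ^ n. exp (- a * (real k * h))))"
        by (simp add: sum_distrib_left mult_ac)
      also have "\<dots> \<le> \<epsilon> * (1 / a + h)"
        using \<open>\<epsilon> \<ge> 0\<close> sum_exp_le[OF \<open>a > 0\<close> h(1)] by (intro mult_left_mono)
      also have "\<dots> \<le> \<epsilon> * (1 / a + 1)"
        using \<open>\<epsilon> \<ge> 0\<close> h by (intro mult_left_mono) auto
      finally show ?thesis .
    qed
    then show "\<exists>N. \<forall>n\<ge>N. cmod (\<phi> (S.approx n x) - \<phi> (S'.approx n x)) \<le> \<epsilon> * (1 / a + 1)"
      by auto
  qed
qed

end

section \<open>The implications\<close>

lemma standing_assumptionsD: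
  assumes "standing_assumptions X T Tn M \<omega> D"
  shows "complex_banach_space X" "C0_semigroup X T" "C0_semigroup X (Tn n)" "M \<ge> 1"
    and "t \<ge> 0 \<Longrightarrow> operator_norm X (T t) \<le> M * exp (\<omega> * t)"
    and "t \<ge> 0 \<Longrightarrow> operator_norm X (Tn n t) \<le> M * exp (\<omega> * t)"
    and "D \<subseteq> opdom (generator X T)"
  using assms by (auto simp: standing_assumptions_def core_for_def)

lemma core_imp_graph_weak_convergence:
  assumes st: "standing_assumptions X T Tn M \<omega> D"
    and core: "core_weak_convergence X (generator X T) (\<lambda>n. generator X (Tn n)) D"
  shows "graph_weak_convergence X (generator X T) (\<lambda>n. generator X (Tn n)) D"
  unfolding graph_weak_convergence_def
proof
  interpret complex_banach_space X
    by (rule standing_assumptionsD[OF st])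
  fix x assume x: "x \<in> D"
  then have "x \<in> carrier X"
    using standing_assumptionsD(7)[OF st] by (auto simp: generator_def)
  then have "weakly_converges X (\<lambda>_. x) x"
    by (simp add: weakly_converges_iff)
  then show "\<exists>xs. (\<forall>n. xs n \<in> opdom (generator X (Tn n))) \<and> weakly_converges X xs x \<and>
      weakly_converges X (\<lambda>n. opfun (generator X (Tn n)) (xs n)) (opfun (generator X T) x)"
    using core x unfolding core_weak_convergence_def by (intro exI[of _ "\<lambda>_. x"]) auto
qed

lemma resolvent_imp_graph_weak_convergence:
  assumes st: "standing_assumptions X T Tn M \<omega> D"
    and res: "resolvent_weak_convergence X (generator X T) (\<lambda>n. generator X (Tn n)) \<omega>"
  shows "graph_weak_convergence X (generator X T) (\<lambda>n. generator X (Tn n)) D"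
  unfolding graph_weak_convergence_def
proof
  note st' = standing_assumptionsD[OF st]
  interpret complex_banach_space X
    by (rule st')
  fix x assume "x \<in> D"
  then have x: "x \<in> opdom (generator X T)"
    using st'(7) by auto
  define y where "y = opfun (generator X T) x"
  have car: "x \<in> carrier X" "y \<in> carrier X"
    using x opfun_generator_closed by (auto simp: opdom_generator y_def)
  obtain z where z: "Re z > \<omega>"
    and conv: "\<And>x. x \<in> carrier X \<Longrightarrow>
      weakly_converges X (\<lambda>n. resolvent X z (generator X (Tn n)) x) (resolvent X z (generator X T) x)"
    using res by (auto simp: resolvent_weak_convergence_def)
  \<comment> \<open>Chosen so that the limit resolvent sends \<open>w\<close> back to
    \<open>x\<close>; the resolvents of the approximating generators at \<open>w\<close> then
    converge weakly to \<open>x\<close>.\<close>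
  define w where "w = z \<odot>\<^bsub>X\<^esub> x \<ominus>\<^bsub>X\<^esub> y"
  have w: "w \<in> carrier X"
    using car by (simp add: w_def)
  define xs where "xs n = resolvent X z (generator X (Tn n)) w" for n
  have xs: "xs n \<in> opdom (generator X (Tn n))" for n
    unfolding xs_def by (rule resolvent_in_generator_domain[OF st'(3,4) _ z w]) (rule st')
  then have xs': "xs n \<in> carrier X" for n
    by (auto simp: opdom_generator)
  have "resolvent X z (generator X T) w = x"
    unfolding w_def y_def by (rule resolvent_generator[OF st'(2,4) _ z x]) (rule st')
  then have xs_lim: "weakly_converges X xs x"
    using conv[OF w] by (simp add: xs_def[abs_def])
  \<comment> \<open>As \<open>A R = z R - I\<close>, the images differ from a multiple of
    \<open>xs n\<close> by a fixed vector, and their weak limit is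
    \<open>z x - w = y\<close>.\<close>
  have A_xs: "opfun (generator X (Tn n)) (xs n) = z \<odot>\<^bsub>X\<^esub> xs n \<ominus>\<^bsub>X\<^esub> w" for n
    unfolding xs_def by (rule opfun_generator_resolvent[OF st'(3,4) _ z w]) (rule st')
  have "weakly_converges X (\<lambda>n. z \<odot>\<^bsub>X\<^esub> xs n \<ominus>\<^bsub>X\<^esub> w) y"
  proof (subst weakly_converges_iff, safe)
    fix \<phi> assume \<phi>: "\<phi> \<in> dual_space X"
    have "(\<lambda>n. z * \<phi> (xs n) - \<phi> w) \<longlonglongrightarrow> z * \<phi> x - \<phi> w"
      using xs_lim xs' \<phi> by (intro tendsto_intros) (simp add: weakly_converges_iff)
    then show "(\<lambda>n. \<phi> (z \<odot>\<^bsub>X\<^esub> xs n \<ominus>\<^bsub>X\<^esub> w)) \<longlonglongrightarrow> \<phi> y"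
      using \<phi> xs' car w by (simp add: w_def dual_minus dual_smult)
  qed (use xs' w car in auto)
  then show "\<exists>xs. (\<forall>n. xs n \<in> opdom (generator X (Tn n))) \<and> weakly_converges X xs x \<and>
      weakly_converges X (\<lambda>n. opfun (generator X (Tn n)) (xs n)) (opfun (generator X T) x)"
    using xs xs_lim A_xs by (intro exI[of _ xs]) (simp add: y_def)
qed

lemma semigroup_imp_resolvent_weak_convergence:
  assumes st: "standing_assumptions X T Tn M \<omega> D"
    and conv: "semigroup_weak_convergence X T Tn"
  shows "resolvent_weak_convergence X (generator X T) (\<lambda>n. generator X (Tn n)) \<omega>"
proof -
  note st' = standing_assumptionsD[OF st]
  interpret complex_banach_space X
    by (rule st')
  \<comment> \<open>Distance 1 from the growth bound leaves a decay \<open>exp (- t)\<close>. One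
    half of it makes the tail small, the other half stays as the summable weight.\<close>
  define z where "z = complex_of_real (\<omega> + 1)"
  have z: "Re z > \<omega>"
    by (simp add: z_def)
  note bound = vnorm_semigroup_le[OF st'(2,4,5)] and bound_n = vnorm_semigroup_le[OF st'(3,4,6)]
  note decay = decaying_semigroup_rescale[OF st'(2,4,5) z]
    and decay_n = decaying_semigroup_rescale[OF st'(3,4,6) z]
  note res = resolvent_eq_lap[OF st'(2,4,5) z] and res_n = resolvent_eq_lap[OF st'(3,4,6) z]
  have "weakly_converges X (\<lambda>n. resolvent X z (generator X (Tn n)) x) (resolvent X z (generator X T) x)"
    if x: "x \<in> carrier X" for x
  proof -
    let ?R = "decaying_semigroup.lap X (rescale X z T) x"
    let ?Rn = "\<lambda>n. decaying_semigroup.lap X (rescale X z (Tn n)) x"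
    have car: "?R \<in> carrier X" "?Rn n \<in> carrier X" for n
      using decaying_semigroup.lap_closed[OF decay x] decaying_semigroup.lap_closed[OF decay_n x] by auto
    have "(\<lambda>n. \<phi> (?Rn n)) \<longlonglongrightarrow> \<phi> ?R" if \<phi>: "\<phi> \<in> dual_space X" for \<phi>
    proof (rule tendstoI)
      fix e :: real assume e: "e > 0"
      obtain C where C: "C \<ge> 0" "\<And>x. x \<in> carrier X \<Longrightarrow> cmod (\<phi> x) \<le> C * vnorm X x"
        using dual_bound[OF \<phi>] by blast
      define \<Delta> where "\<Delta> n t = cmod (\<phi> (Tn n t x \<ominus>\<^bsub>X\<^esub> T t x))" for n t
      define K where "K = 2 * C * M * vnorm X x"
      have \<Delta>_le: "\<Delta> n t \<le> K * exp (\<omega> * t)" if "t \<ge> 0" for n t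
      proof -
        have Tx: "Tn n t x \<in> carrier X" "T t x \<in> carrier X"
          using that x st'(2,3) by (auto intro: C0_semigroup_closed)
        then have "\<Delta> n t \<le> cmod (\<phi> (Tn n t x)) + cmod (\<phi> (T t x))"
          by (simp add: \<Delta>_def dual_minus[OF \<phi>] norm_triangle_ineq4)
        also have "\<dots> \<le> C * vnorm X (Tn n t x) + C * vnorm X (T t x)"
          using Tx by (intro add_mono C(2))
        also have "\<dots> \<le> C * (M * exp (\<omega> * t) * vnorm X x) + C * (M * exp (\<omega> * t) * vnorm X x)"
          using C(1) that x by (intro add_mono mult_left_mono bound bound_n)
        finally show ?thesis
          by (simp add: K_def mult_ac)
      qed
      have K: "K \<ge> 0"
        using C(1) st'(4) x vnorm_nonneg by (simp add: K_def)
      have diff: "cmod (\<phi> (rescale X z (Tn n) t x) - \<phi> (rescale X z T t x)) =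
          exp (- (\<omega> + 1) * t) * \<Delta> n t" if "t \<ge> 0" for n t
      proof -
        have "Tn n t x \<in> carrier X" "T t x \<in> carrier X"
          using that x st'(2,3) by (auto intro: C0_semigroup_closed)
        then show ?thesis
          by (simp add: rescale_def \<Delta>_def dual_smult[OF \<phi>] dual_minus[OF \<phi>] z_def norm_mult norm_exp_eq_Re
              flip: right_diff_distrib)
      qed
      \<comment> \<open>With weight \<open>exp (- t / 2)\<close> the comparison of the transforms
        costs a factor \<open>1 / (1 / 2) + 1 = 3\<close>, so the final error is
        \<open>e / 2\<close>.\<close>
      define \<epsilon> where "\<epsilon> = e / 6"
      have \<epsilon>: "\<epsilon> > 0"
        using e by (simp add: \<epsilon>_def)
      have "((\<lambda>t. K * exp (- t / 2)) \<longlongrightarrow> 0) at_top"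
        by real_asymp
      then have "\<forall>\<^sub>F t in at_top. K * exp (- t / 2) < \<epsilon>"
        using \<epsilon> by (rule order_tendstoD)
      then obtain t1 where t1: "\<And>t. t \<ge> t1 \<Longrightarrow> K * exp (- t / 2) < \<epsilon>"
        by (auto simp: eventually_at_top_linorder)
      define t0 where "t0 = max 1 t1"
      have t0: "t0 > 0" "\<And>t. t \<ge> t0 \<Longrightarrow> K * exp (- t / 2) < \<epsilon>"
        using t1 by (simp_all add: t0_def)
      \<comment> \<open>On \<open>[0, t0]\<close> the factor
        \<open>exp (- (\<omega> + 1) * t)\<close> is at most \<open>exp (- t / 2)\<close> times
        \<open>exp (\<bar>\<omega> + 1 / 2\<bar> * t0)\<close>; \<open>c\<close> compensates the
        second factor.\<close>
      define c where "c = \<epsilon> * exp (- \<bar>\<omega> + 1 / 2\<bar> * t0)"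
      have "(\<lambda>n. SUP t\<in>{0..t0}. \<Delta> n t) \<longlonglongrightarrow> 0"
        using conv \<phi> x t0(1) by (simp add: semigroup_weak_convergence_def \<Delta>_def)
      moreover have "c > 0"
        using \<epsilon> by (simp add: c_def)
      ultimately have "\<forall>\<^sub>F n in sequentially. (SUP t\<in>{0..t0}. \<Delta> n t) < c"
        by (rule order_tendstoD)
      then show "\<forall>\<^sub>F n in sequentially. dist (\<phi> (?Rn n)) (\<phi> ?R) < e"
      proof eventually_elim
        case (elim n)
        \<comment> \<open>A small supremum bounds the single values only because the growth estimate
          makes the set bounded above.\<close>
        have "bdd_above (\<Delta> n ` {0..t0})"
        proof (rule bdd_aboveI2)
          fix t assume t: "t \<in> {0..t0}"
          have "\<omega> * t \<le> \<bar>\<omega>\<bar> * t0"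
            using t by (intro mult_mono) auto
          then have "K * exp (\<omega> * t) \<le> K * exp (\<bar>\<omega>\<bar> * t0)"
            using K by (intro mult_left_mono) auto
          then show "\<Delta> n t \<le> K * exp (\<bar>\<omega>\<bar> * t0)"
            using \<Delta>_le[of t n] t by simp
        qed
        then have small: "\<Delta> n t \<le> c" if "0 \<le> t" "t \<le> t0" for t
          using cSUP_upper[of t "{0..t0}" "\<Delta> n"] that elim by simp
        have "cmod (\<phi> (rescale X z (Tn n) t x) - \<phi> (rescale X z T t x)) \<le> \<epsilon> * exp (- (1 / 2) * t)"
          if t: "t \<ge> 0" for t
        proof (cases "t \<le> t0")
          case True
          have "- (\<omega> + 1 / 2) * t \<le> \<bar>\<omega> + 1 / 2\<bar> * t0"
            using True t by (intro mult_mono) auto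
          have "exp (- (\<omega> + 1) * t) * \<Delta> n t \<le> exp (- (\<omega> + 1) * t) * c"
            using small[OF t True] by (intro mult_left_mono) auto
          also have "\<dots> = \<epsilon> * (exp (- (\<omega> + 1) * t) * exp (- \<bar>\<omega> + 1 / 2\<bar> * t0))"
            by (simp add: c_def)
          also have "\<dots> \<le> \<epsilon> * exp (- (1 / 2) * t)"
          proof -
            have "- (\<omega> + 1) * t + - \<bar>\<omega> + 1 / 2\<bar> * t0 \<le> - (1 / 2) * t"
              using \<open>- (\<omega> + 1 / 2) * t \<le> \<bar>\<omega> + 1 / 2\<bar> * t0\<close> by (simp add: algebra_simps)
            then show ?thesis
              using \<epsilon> by (simp flip: exp_add)
          qed
          finally show ?thesis
            using diff[OF t] by simp
        next
          case False
          \<comment> \<open>Beyond \<open>t0\<close> no convergence is used: the growth bounds alone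
            leave \<open>K * exp (- t)\<close>, and half of this decay brings \<open>K\<close> below
            \<open>\<epsilon>\<close>.\<close>
          have "exp (- (\<omega> + 1) * t) * \<Delta> n t \<le> exp (- (\<omega> + 1) * t) * (K * exp (\<omega> * t))"
            using \<Delta>_le[OF t] by (intro mult_left_mono) auto
          also have "\<dots> = K * (exp (- (\<omega> + 1) * t) * exp (\<omega> * t))"
            by (simp only: mult_ac)
          also have "exp (- (\<omega> + 1) * t) * exp (\<omega> * t) = exp (- t / 2) * exp (- (1 / 2) * t)"
            unfolding exp_add[symmetric] by (simp add: algebra_simps)
          also have "K * (exp (- t / 2) * exp (- (1 / 2) * t)) = K * exp (- t / 2) * exp (- (1 / 2) * t)"
            by (simp only: mult_ac)
          also have "\<dots> \<le> \<epsilon> * exp (- (1 / 2) * t)"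
            using t0(2)[of t] False by (intro mult_right_mono) auto
          finally show ?thesis
            using diff[OF t] by simp
        qed
        then have "cmod (\<phi> (?Rn n) - \<phi> ?R) \<le> \<epsilon> * (1 / (1 / 2) + 1)"
          using \<epsilon> by (intro lap_dual_diff_le[OF decay_n decay \<phi> x]) auto
        then show "dist (\<phi> (?Rn n)) (\<phi> ?R) < e"
          using e by (simp add: dist_norm \<epsilon>_def)
      qed
    qed
    then show ?thesis
      using car x by (simp add: res res_n weakly_converges_iff)
  qed
  then show ?thesis
    unfolding resolvent_weak_convergence_def
    using z in_resolvent_set[OF st'(2,4,5) z] in_resolvent_set[OF st'(3,4,6) z]
    by (intro exI[of _ z] conjI allI ballI)
qed

section \<open>The counterexamples\<close>

definition c0 :: "(nat \<Rightarrow> complex) normed_module" where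
  "c0 = \<lparr>carrier = {x. x \<longlonglongrightarrow> 0}, mult = undefined, one = undefined, zero = (\<lambda>_. 0),
     add = (\<lambda>x y k. x k + y k), smult = (\<lambda>c x k. c * x k), vnorm = (\<lambda>x. SUP k. cmod (x k))\<rparr>"

section \<open>The Banach space of null sequences\<close>

lemma c0_carrier: "x \<in> carrier c0 \<longleftrightarrow> x \<longlonglongrightarrow> 0"
  and c0_zero: "\<zero>\<^bsub>c0\<^esub> = (\<lambda>_. 0)"
  and c0_add: "x \<oplus>\<^bsub>c0\<^esub> y = (\<lambda>k. x k + y k)"
  and c0_smult: "c \<odot>\<^bsub>c0\<^esub> x = (\<lambda>k. c * x k)"
  and c0_vnorm: "vnorm c0 x = (SUP k. cmod (x k))"
  by (simp_all add: c0_def)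

lemma c0_zero_closed: "\<zero>\<^bsub>c0\<^esub> \<in> carrier c0"
  by (simp add: c0_carrier c0_zero)

lemma c0_smult_closed: "x \<in> carrier c0 \<Longrightarrow> c \<odot>\<^bsub>c0\<^esub> x \<in> carrier c0"
  unfolding c0_carrier c0_smult by (rule tendsto_mult_right_zero)

lemma c0_add_closed: "x \<in> carrier c0 \<Longrightarrow> y \<in> carrier c0 \<Longrightarrow> x \<oplus>\<^bsub>c0\<^esub> y \<in> carrier c0"
  unfolding c0_carrier c0_add by (rule tendsto_add_zero)

lemma c0_coord_le:
  assumes "x \<in> carrier c0"
  shows "cmod (x k) \<le> vnorm c0 x"
proof -
  have "Bseq x"
    using assms by (auto simp: c0_carrier intro: convergent_imp_Bseq convergentI)
  then obtain K where "\<And>k. cmod (x k) \<le> K"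
    by (auto simp: Bseq_def)
  then have "bdd_above (range (\<lambda>k. cmod (x k)))"
    by (rule bdd_aboveI2)
  then show ?thesis
    unfolding c0_vnorm by (intro cSUP_upper) auto
qed

lemma c0_vnorm_le: "(\<And>k. cmod (x k) \<le> B) \<Longrightarrow> vnorm c0 x \<le> B"
  unfolding c0_vnorm by (rule cSUP_least) auto

interpretation c0: complex_normed_space c0
proof -
  have "abelian_group c0"
  proof (rule abelian_groupI)
    fix x assume "x \<in> carrier c0"
    then show "\<exists>y\<in>carrier c0. y \<oplus>\<^bsub>c0\<^esub> x = \<zero>\<^bsub>c0\<^esub>"
      using c0_smult_closed[of x "- 1"]
      by (intro bexI[of _ "(- 1) \<odot>\<^bsub>c0\<^esub> x"]) (auto simp: c0_add c0_smult c0_zero)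
  qed (auto simp: c0_add c0_zero add_ac c0_add_closed[unfolded c0_add] c0_zero_closed[unfolded c0_zero])
  then have "Module.module complex_field c0"
    by (intro moduleI cring_complex_field c0_smult_closed)
      (auto simp: c0_add c0_smult algebra_simps)
  then show "complex_normed_space c0"
  proof (intro complex_normed_space.intro complex_normed_space_axioms.intro)
    fix x y :: "nat \<Rightarrow> complex" and c assume x: "x \<in> carrier c0"
    show "0 \<le> vnorm c0 x"
      using c0_coord_le[OF x, of 0] norm_ge_zero[of "x 0"] by linarith
    show "vnorm c0 x = 0 \<longleftrightarrow> x = \<zero>\<^bsub>c0\<^esub>"
      using c0_coord_le[OF x] by (auto simp: c0_zero fun_eq_iff) (simp add: c0_vnorm)
    show "vnorm c0 (x \<oplus>\<^bsub>c0\<^esub> y) \<le> vnorm c0 x + vnorm c0 y" if "y \<in> carrier c0"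
      unfolding c0_add by (intro c0_vnorm_le norm_triangle_mono c0_coord_le x that)
    have le: "vnorm c0 (c \<odot>\<^bsub>c0\<^esub> x) \<le> cmod c * vnorm c0 x" if "x \<in> carrier c0" for c x
      unfolding c0_smult using c0_coord_le[OF that]
      by (intro c0_vnorm_le) (simp add: norm_mult mult_left_mono)
    \<comment> \<open>The reverse inequality is the one just shown, applied to the factor
      \<open>inverse c\<close>.\<close>
    have "cmod c * vnorm c0 x \<le> vnorm c0 (c \<odot>\<^bsub>c0\<^esub> x)" if "c \<noteq> 0"
    proof -
      have "inverse c \<odot>\<^bsub>c0\<^esub> (c \<odot>\<^bsub>c0\<^esub> x) = x"
        using that by (simp add: c0_smult fun_eq_iff flip: mult.assoc)
      then have "vnorm c0 x \<le> inverse (cmod c) * vnorm c0 (c \<odot>\<^bsub>c0\<^esub> x)"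
        using le[OF c0_smult_closed[OF x], of "inverse c" c] by (simp add: norm_inverse)
      then show ?thesis
        using that by (simp add: field_simps)
    qed
    then show "vnorm c0 (c \<odot>\<^bsub>c0\<^esub> x) = cmod c * vnorm c0 x"
      using le[OF x, of c] by (cases "c = 0") (auto simp: c0_smult c0_vnorm)
  qed
qed

lemma c0_minus:
  assumes "x \<in> carrier c0" "y \<in> carrier c0"
  shows "x \<ominus>\<^bsub>c0\<^esub> y = (\<lambda>k. x k - y k)"
  using assms by (simp add: c0.M.minus_eq c0.vminus_eq_smult c0_add c0_smult)

lemma c0_vdist: "x \<in> carrier c0 \<Longrightarrow> y \<in> carrier c0 \<Longrightarrow> vdist c0 x y = vnorm c0 (\<lambda>k. x k - y k)"
  by (simp add: c0.vdist_eq c0_minus)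

lemma c0_finsum:
  assumes "f \<in> A \<rightarrow> carrier c0"
  shows "finsum c0 f A = (\<lambda>k. \<Sum>a\<in>A. f a k)"
  using assms
proof (induction A rule: infinite_finite_induct)
  case (insert a A)
  then show ?case
    by (simp add: Pi_iff c0_add)
qed (simp_all add: c0_zero c0.M.add.finprod_infinite)

interpretation c0: complex_banach_space c0
proof unfold_locales
  show "c0.metric.mcomplete"
    unfolding c0.metric.mcomplete_def
  proof (intro allI impI)
    fix \<sigma> assume \<sigma>: "c0.metric.MCauchy \<sigma>"
    then have car: "\<sigma> n \<in> carrier c0" for n
      by (auto simp: c0.metric.MCauchy_def)
    have coord: "cmod (\<sigma> m k - \<sigma> n k) \<le> vdist c0 (\<sigma> m) (\<sigma> n)" for m n k
      using c0_coord_le[OF c0.vminus_closed[OF car car], of m n k] car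
      by (simp add: c0_vdist c0_minus)
    have cauchy: "\<exists>N. \<forall>m\<ge>N. \<forall>n\<ge>N. vdist c0 (\<sigma> m) (\<sigma> n) < e" if "e > 0" for e
      using \<sigma> that by (auto simp: c0.metric.MCauchy_def)
    have "Cauchy (\<lambda>n. \<sigma> n k)" for k
    proof (rule metric_CauchyI)
      fix e :: real assume "e > 0"
      then show "\<exists>N. \<forall>m\<ge>N. \<forall>n\<ge>N. dist (\<sigma> m k) (\<sigma> n k) < e"
        using cauchy[of e] coord le_less_trans unfolding dist_norm by meson
    qed
    then have "\<exists>l. (\<lambda>n. \<sigma> n k) \<longlonglongrightarrow> l" for k
      by (simp add: Cauchy_convergent convergentD)
    then obtain L where L: "\<And>k. (\<lambda>n. \<sigma> n k) \<longlonglongrightarrow> L k"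
      by metis
    \<comment> \<open>Letting one index of the Cauchy estimate tend to infinity makes the
      coordinatewise convergence uniform in \<open>k\<close>; this puts the limit into
      \<open>c0\<close> and gives convergence in norm.\<close>
    have unif: "\<exists>N. \<forall>n\<ge>N. \<forall>k. cmod (\<sigma> n k - L k) \<le> e" if e: "e > 0" for e
    proof -
      obtain N where N: "\<And>m n. m \<ge> N \<Longrightarrow> n \<ge> N \<Longrightarrow> vdist c0 (\<sigma> m) (\<sigma> n) < e"
        using cauchy[OF e] by blast
      have "cmod (\<sigma> n k - L k) \<le> e" if "n \<ge> N" for n k
      proof (rule LIMSEQ_le_const2)
        show "(\<lambda>m. cmod (\<sigma> n k - \<sigma> m k)) \<longlonglongrightarrow> cmod (\<sigma> n k - L k)"
          by (intro tendsto_intros L)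
        show "\<exists>M. \<forall>m\<ge>M. cmod (\<sigma> n k - \<sigma> m k) \<le> e"
          using N[OF that] coord by (meson less_imp_le order_trans)
      qed
      then show ?thesis
        by blast
    qed
    have "L \<longlonglongrightarrow> 0"
    proof (rule LIMSEQ_I)
      fix e :: real assume "e > 0"
      then obtain N where N: "\<And>k. cmod (\<sigma> N k - L k) \<le> e / 2"
        using unif[of "e / 2"] by auto
      have "\<sigma> N \<longlonglongrightarrow> 0"
        using car by (simp add: c0_carrier)
      then obtain K where K: "\<And>k. k \<ge> K \<Longrightarrow> cmod (\<sigma> N k - 0) < e / 2"
        using LIMSEQ_D[of "\<sigma> N" 0 "e / 2"] \<open>e > 0\<close> by auto
      have "cmod (L k - 0) < e" if "k \<ge> K" for k
        using norm_triangle_ineq4[of "\<sigma> N k" "\<sigma> N k - L k"] N[of k] K[OF that] by simp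
      then show "\<exists>K. \<forall>k\<ge>K. cmod (L k - 0) < e"
        by blast
    qed
    then have Lc: "L \<in> carrier c0"
      by (simp add: c0_carrier)
    have "limitin c0.metric.mtopology \<sigma> L sequentially"
      unfolding c0.metric.limit_metric_sequentially
    proof (intro conjI allI impI Lc)
      fix e :: real assume "e > 0"
      then obtain N where N: "\<And>n k. n \<ge> N \<Longrightarrow> cmod (\<sigma> n k - L k) \<le> e / 2"
        using unif[of "e / 2"] by auto
      have "vdist c0 (\<sigma> n) L \<le> e / 2" if "n \<ge> N" for n
        unfolding c0_vdist[OF car Lc] by (rule c0_vnorm_le[OF N[OF that]])
      then show "\<exists>N. \<forall>n\<ge>N. \<sigma> n \<in> carrier c0 \<and> vdist c0 (\<sigma> n) L < e"
        using car \<open>e > 0\<close> by (intro exI[of _ N]) (fastforce intro: le_less_trans)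
    qed
    then show "\<exists>x. limitin c0.metric.mtopology \<sigma> x sequentially"
      by blast
  qed
qed

text \<open>The operator \<open>a + b U\<close>, where \<open>U\<close> composes a sequence with
  \<open>\<pi>\<close>. For an involution \<open>\<pi>\<close> these operators form a commutative
  algebra, which contains \<open>U\<close>, the semigroup generated by \<open>U\<close> and its
  resolvents.\<close>

definition pair_op :: "(nat \<Rightarrow> nat) \<Rightarrow> complex \<Rightarrow> complex \<Rightarrow> (nat \<Rightarrow> complex) \<Rightarrow> nat \<Rightarrow> complex" where
  "pair_op \<pi> a b x = (\<lambda>k. a * x k + b * x (\<pi> k))"

section \<open>The algebra generated by a permutation of coordinates\<close>

context
  fixes \<pi> :: "nat \<Rightarrow> nat"
  assumes \<pi>_lim: "filterlim \<pi> sequentially sequentially"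
begin

lemma comp_closed: "x \<in> carrier c0 \<Longrightarrow> (\<lambda>k. x (\<pi> k)) \<in> carrier c0"
  unfolding c0_carrier by (rule filterlim_compose[OF _ \<pi>_lim])

lemma pair_op_closed: "x \<in> carrier c0 \<Longrightarrow> pair_op \<pi> a b x \<in> carrier c0"
  using comp_closed unfolding pair_op_def c0_carrier
  by (intro tendsto_add_zero tendsto_mult_right_zero)

lemma vnorm_pair_op_le:
  assumes "x \<in> carrier c0"
  shows "vnorm c0 (pair_op \<pi> a b x) \<le> (cmod a + cmod b) * vnorm c0 x"
proof (rule c0_vnorm_le)
  fix k
  have "cmod (pair_op \<pi> a b x k) \<le> cmod a * cmod (x k) + cmod b * cmod (x (\<pi> k))"
    by (simp add: pair_op_def norm_triangle_le norm_mult)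
  also have "\<dots> \<le> cmod a * vnorm c0 x + cmod b * vnorm c0 x"
    using c0_coord_le[OF assms] by (intro add_mono mult_left_mono) auto
  finally show "cmod (pair_op \<pi> a b x k) \<le> (cmod a + cmod b) * vnorm c0 x"
    by (simp add: distrib_right)
qed

lemma bounded_operator_pair_op: "bounded_operator c0 (pair_op \<pi> a b)"
  unfolding bounded_operator_def
proof (intro conjI ballI allI exI)
  show "vnorm c0 (pair_op \<pi> a b x) \<le> (cmod a + cmod b) * vnorm c0 x" if "x \<in> carrier c0" for x
    using that by (rule vnorm_pair_op_le)
qed (auto simp: pair_op_closed, auto simp: pair_op_def c0_add c0_smult algebra_simps)

lemma operator_norm_pair_op_le: "operator_norm c0 (pair_op \<pi> a b) \<le> cmod a + cmod b"
  unfolding operator_norm_def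
proof (rule cSUP_least)
  fix x assume x: "x \<in> carrier c0"
  show "vnorm c0 (pair_op \<pi> a b x) / vnorm c0 x \<le> cmod a + cmod b"
    using vnorm_pair_op_le[OF x, of a b] c0.vnorm_nonneg[OF x]
    by (cases "vnorm c0 x = 0") (auto simp: divide_le_eq)
qed (use c0_zero_closed in auto)

lemma limitin_pair_op:
  assumes x: "x \<in> carrier c0" and lim: "(a \<longlongrightarrow> a') F" "(b \<longlongrightarrow> b') F"
  shows "limitin (norm_topology c0) (\<lambda>y. pair_op \<pi> (a y) (b y) x) (pair_op \<pi> a' b' x) F"
proof -
  have eq: "pair_op \<pi> (a y) (b y) x = a y \<odot>\<^bsub>c0\<^esub> x \<oplus>\<^bsub>c0\<^esub> b y \<odot>\<^bsub>c0\<^esub> (\<lambda>k. x (\<pi> k))"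
    "pair_op \<pi> a' b' x = a' \<odot>\<^bsub>c0\<^esub> x \<oplus>\<^bsub>c0\<^esub> b' \<odot>\<^bsub>c0\<^esub> (\<lambda>k. x (\<pi> k))" for y
    by (simp_all add: pair_op_def c0_add c0_smult)
  show ?thesis
    unfolding eq using x lim
    by (intro c0.limitin_norm_add c0.limitin_norm_smult c0.limitin_norm_const comp_closed)
qed

context
  assumes involution: "\<And>k. \<pi> (\<pi> k) = k"
  fixes c s :: "real \<Rightarrow> real" and a b :: real
  assumes zero: "c 0 = 1" "s 0 = 0"
    and add: "\<And>u v. c (u + v) = c u * c v + s u * s v" "\<And>u v. s (u + v) = s u * c v + c u * s v"
    and cont: "continuous_on UNIV c" "continuous_on UNIV s"
    and deriv: "(c has_real_derivative a) (at 0)" "(s has_real_derivative b) (at 0)"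
begin

text \<open>The addition theorems for \<open>c\<close> and \<open>s\<close> are the product
  \<open>(c u + s u U) (c t + s t U)\<close> expanded with \<open>U U = I\<close>. The pairs
  \<open>cosh\<close>, \<open>sinh\<close> and \<open>exp\<close>, \<open>0\<close> are the intended
  instances.\<close>

lemma C0_semigroup_pair_op: "C0_semigroup c0 (\<lambda>t. pair_op \<pi> (c t) (s t))"
  unfolding C0_semigroup_def
proof (intro conjI allI ballI impI bounded_operator_pair_op)
  fix x assume x: "x \<in> carrier c0"
  show "pair_op \<pi> (c 0) (s 0) x = x"
    by (simp add: pair_op_def zero)
  show "pair_op \<pi> (c (u + t)) (s (u + t)) x = pair_op \<pi> (c u) (s u) (pair_op \<pi> (c t) (s t) x)" for u t
    by (simp add: pair_op_def add involution algebra_simps)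
  show "continuous_map (top_of_set {0..}) (norm_topology c0) (\<lambda>t. pair_op \<pi> (c t) (s t) x)"
  proof (rule continuous_map_atLeast_zeroI)
    fix u :: real
    have "(c \<longlongrightarrow> c u) (at u within {0..})" "(s \<longlongrightarrow> s u) (at u within {0..})"
      using cont by (auto simp: continuous_on_def intro: tendsto_within_subset)
    then show "limitin (norm_topology c0) (\<lambda>t. pair_op \<pi> (c t) (s t) x) (pair_op \<pi> (c u) (s u) x)
        (at u within {0..})"
      using x by (intro limitin_pair_op tendsto_of_real)
  qed
qed

text \<open>The difference quotient is again a pair operator, so its limit is a limit of two scalar
  coefficients and exists at every vector.\<close>

lemma generates_at_pair_op:
  assumes x: "x \<in> carrier c0"
  shows "generates_at c0 (\<lambda>t. pair_op \<pi> (c t) (s t)) x (pair_op \<pi> a b x)"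
proof -
  have "((\<lambda>t. (c t - 1) / t) \<longlongrightarrow> a) (at_right 0)" "((\<lambda>t. s t / t) \<longlongrightarrow> b) (at_right 0)"
    using deriv zero by (auto simp: DERIV_def intro: tendsto_within_subset)
  then have "limitin (norm_topology c0)
      (\<lambda>t. pair_op \<pi> (complex_of_real ((c t - 1) / t)) (complex_of_real (s t / t)) x)
      (pair_op \<pi> a b x) (at_right 0)"
    using x by (intro limitin_pair_op tendsto_of_real)
  moreover have "pair_op \<pi> (complex_of_real ((c t - 1) / t)) (complex_of_real (s t / t)) x =
      complex_of_real (1 / t) \<odot>\<^bsub>c0\<^esub> (pair_op \<pi> (c t) (s t) x \<ominus>\<^bsub>c0\<^esub> x)" for t
    using x by (simp add: c0_minus pair_op_closed)
      (auto simp: pair_op_def c0_smult fun_eq_iff diff_divide_distrib add_divide_distrib algebra_simps)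
  ultimately show ?thesis
    by (simp add: generates_at_def)
qed

lemma generator_pair_op:
  shows opdom_generator_pair_op: "opdom (generator c0 (\<lambda>t. pair_op \<pi> (c t) (s t))) = carrier c0"
    and opfun_generator_pair_op: "x \<in> carrier c0 \<Longrightarrow>
      opfun (generator c0 (\<lambda>t. pair_op \<pi> (c t) (s t))) x = pair_op \<pi> a b x"
proof -
  show "opdom (generator c0 (\<lambda>t. pair_op \<pi> (c t) (s t))) = carrier c0"
    by (rule Set.set_eqI) (metis c0.opdom_generator generates_at_pair_op)
  show "opfun (generator c0 (\<lambda>t. pair_op \<pi> (c t) (s t))) x = pair_op \<pi> a b x"
    if "x \<in> carrier c0"
    by (intro c0.opfun_generator generates_at_pair_op that)
qed

end

end

section \<open>Functionals on null sequences and the swaps\<close>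

definition unit_vec :: "nat \<Rightarrow> nat \<Rightarrow> complex" where
  "unit_vec j = (\<lambda>k. if k = j then 1 else 0)"

lemma finite_support_in_c0:
  assumes "\<And>k. k \<ge> K \<Longrightarrow> x k = 0"
  shows "x \<in> carrier c0"
  unfolding c0_carrier
  by (rule tendsto_eventually) (use assms in \<open>auto simp: eventually_sequentially\<close>)

lemma unit_vec_closed: "unit_vec j \<in> carrier c0"
  by (rule finite_support_in_c0[of "Suc j"]) (auto simp: unit_vec_def)

text \<open>The index map \<open>f\<close> is the identity when \<open>\<phi>\<close> is tested on
  sign vectors and the shift by \<open>n\<close> when it is tested on swapped vectors.\<close>

lemma dual_finite_support:
  assumes \<phi>: "\<phi> \<in> dual_space c0"
  shows "\<phi> (\<lambda>k. \<Sum>j<K. x j * unit_vec (f j) k) = (\<Sum>j<K. x j * \<phi> (unit_vec (f j)))"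
proof -
  have "(\<lambda>k. \<Sum>j<K. x j * unit_vec (f j) k) = finsum c0 (\<lambda>j. x j \<odot>\<^bsub>c0\<^esub> unit_vec (f j)) {..<K}"
    by (subst c0_finsum) (auto simp: c0_smult_closed unit_vec_closed, simp add: c0_smult)
  moreover have "(\<lambda>j. x j \<odot>\<^bsub>c0\<^esub> unit_vec (f j)) \<in> {..<K} \<rightarrow> carrier c0"
    by (auto simp: c0_smult_closed unit_vec_closed)
  ultimately show ?thesis
    using \<phi> by (simp add: c0.dual_finsum dual_smult unit_vec_closed)
qed

text \<open>Testing \<open>\<phi>\<close> on vectors of conjugate signs shows that its coefficients are summable.\<close>

lemma dual_unit_vec_tendsto_zero:
  assumes \<phi>: "\<phi> \<in> dual_space c0"
  shows "(\<lambda>j. \<phi> (unit_vec j)) \<longlonglongrightarrow> 0"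
proof -
  obtain C where C: "C \<ge> 0" "\<And>x. x \<in> carrier c0 \<Longrightarrow> cmod (\<phi> x) \<le> C * vnorm c0 x"
    using c0.dual_bound[OF \<phi>] by blast
  define w where "w j = cnj (sgn (\<phi> (unit_vec j)))" for j
  have w: "w j * \<phi> (unit_vec j) = complex_of_real (cmod (\<phi> (unit_vec j)))" for j
    by (simp add: w_def sgn_div_norm scaleR_conv_of_real field_simps complex_norm_square[symmetric]
        power2_eq_square)
  have "(\<Sum>j<K. cmod (\<phi> (unit_vec j))) \<le> C" for K
  proof -
    define x where "x = (\<lambda>k. \<Sum>j<K. w j * unit_vec j k)"
    have xk: "x k = (if k < K then w k else 0)" for k
      by (simp add: x_def unit_vec_def if_distrib[of "(*) _"] sum.delta' cong: if_cong)
    have "cmod (w j) \<le> 1" for j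
      by (simp add: w_def norm_sgn)
    then have "vnorm c0 x \<le> 1"
      by (intro c0_vnorm_le) (simp add: xk)
    moreover have "x \<in> carrier c0"
      by (rule finite_support_in_c0[of K]) (simp add: xk)
    ultimately have "cmod (\<phi> x) \<le> C"
      using C(2)[of x] mult_left_mono[of "vnorm c0 x" 1 C] C(1) by simp
    moreover have "\<phi> x = complex_of_real (\<Sum>j<K. cmod (\<phi> (unit_vec j)))"
      unfolding x_def using dual_finite_support[OF \<phi>, where f = "\<lambda>j. j"] w by simp
    ultimately show ?thesis
      by (simp only: norm_of_real)
  qed
  then have "summable (\<lambda>j. cmod (\<phi> (unit_vec j)))"
    by (intro summableI_nonneg_bounded) auto
  then show ?thesis
    using summable_LIMSEQ_zero tendsto_norm_zero_iff by blast
qed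

definition swap :: "nat \<Rightarrow> nat \<Rightarrow> nat" where
  "swap n k = (if k < n then k + n else if k < 2 * n then k - n else k)"

lemma swap_swap [simp]: "swap n (swap n k) = k"
  by (auto simp: swap_def)

lemma filterlim_swap: "filterlim (swap n) sequentially sequentially"
proof -
  have "\<forall>\<^sub>F k in sequentially. swap n k = k"
    using eventually_ge_at_top[of "2 * n"] by eventually_elim (auto simp: swap_def)
  then show ?thesis
    by (subst filterlim_cong[OF refl refl]) (auto intro: filterlim_ident)
qed

text \<open>Cut \<open>x\<close> into finitely many leading coordinates and a uniformly small rest.
  The swap carries the leading coordinates to positions from \<open>n\<close> on, where the
  coefficients of \<open>\<phi>\<close> tend to 0, and it keeps the rest uniformly small.\<close>

lemma swap_weak_tendsto_zero:
  assumes \<phi>: "\<phi> \<in> dual_space c0" and x: "x \<in> carrier c0"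
  shows "(\<lambda>n. \<phi> (\<lambda>k. x (swap n k))) \<longlonglongrightarrow> 0"
proof (rule LIMSEQ_I)
  fix e :: real assume e: "e > 0"
  obtain C where C: "C \<ge> 0" "\<And>x. x \<in> carrier c0 \<Longrightarrow> cmod (\<phi> x) \<le> C * vnorm c0 x"
    using c0.dual_bound[OF \<phi>] by blast
  define \<epsilon> where "\<epsilon> = e / 2 / (C + 1)"
  have \<epsilon>: "\<epsilon> > 0"
    using e C(1) by (simp add: \<epsilon>_def)
  have "C * \<epsilon> \<le> (C + 1) * \<epsilon>"
    using \<epsilon> by (intro mult_right_mono) auto
  also have "\<dots> = e / 2"
    unfolding \<epsilon>_def by (subst times_divide_eq_right, rule nonzero_mult_div_cancel_left) (use C in simp)
  finally have C\<epsilon>: "C * \<epsilon> \<le> e / 2" .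
  obtain K where K: "\<And>k. k \<ge> K \<Longrightarrow> cmod (x k) < \<epsilon>"
    using LIMSEQ_D[OF x[unfolded c0_carrier] \<epsilon>] by auto
  define r where "r k = (if k < K then 0 else x k)" for k
  have r: "r \<in> carrier c0"
    unfolding c0_carrier
  proof (rule Lim_null_comparison)
    show "\<forall>\<^sub>F k in sequentially. cmod (r k) \<le> cmod (x k)"
      by (simp add: r_def)
    show "(\<lambda>k. cmod (x k)) \<longlonglongrightarrow> 0"
      using x by (simp add: c0_carrier tendsto_norm_zero)
  qed
  have rest: "cmod (\<phi> (\<lambda>k. r (swap n k))) \<le> e / 2" for n
  proof -
    have "cmod (r k) \<le> \<epsilon>" for k
      using K[of k] \<epsilon> by (auto simp: r_def not_less)
    then have "vnorm c0 (\<lambda>k. r (swap n k)) \<le> \<epsilon>"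
      by (intro c0_vnorm_le)
    then have "C * vnorm c0 (\<lambda>k. r (swap n k)) \<le> C * \<epsilon>"
      using C(1) by (rule mult_left_mono)
    then show ?thesis
      using C(2)[OF comp_closed[OF filterlim_swap r], of n] C\<epsilon> by linarith
  qed
  have split: "\<phi> (\<lambda>k. x (swap n k)) = (\<Sum>j<K. x j * \<phi> (unit_vec (j + n))) + \<phi> (\<lambda>k. r (swap n k))"
    if n: "n \<ge> K" for n
  proof -
    define p where "p = (\<lambda>k. \<Sum>j<K. x j * unit_vec (j + n) k)"
    \<comment> \<open>Since \<open>n \<ge> K\<close>, all leading coordinates lie in the first block
      and are shifted by exactly \<open>n\<close>.\<close>
    have "unit_vec (j + n) k = unit_vec j (swap n k)" if "j < K" for j k
      using that n by (auto simp: unit_vec_def swap_def split: if_splits)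
    then have "p = (\<lambda>k. \<Sum>j<K. x j * unit_vec j (swap n k))"
      by (simp add: p_def)
    then have p: "p k = (if swap n k < K then x (swap n k) else 0)" for k
      by (simp add: unit_vec_def if_distrib[of "(*) _"] sum.delta' cong: if_cong)
    have "p \<in> carrier c0"
      by (rule finite_support_in_c0[of "K + n"]) (auto simp: p swap_def)
    moreover have "(\<lambda>k. x (swap n k)) = p \<oplus>\<^bsub>c0\<^esub> (\<lambda>k. r (swap n k))"
      by (auto simp: c0_add p r_def)
    ultimately have "\<phi> (\<lambda>k. x (swap n k)) = \<phi> p + \<phi> (\<lambda>k. r (swap n k))"
      using dual_add[OF \<phi> _ comp_closed[OF filterlim_swap r]] by simp
    then show ?thesis
      unfolding p_def by (simp add: dual_finite_support[OF \<phi>])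
  qed
  have "(\<lambda>n. \<Sum>j<K. x j * \<phi> (unit_vec (j + n))) \<longlonglongrightarrow> (\<Sum>j<K. x j * 0)"
  proof (intro tendsto_intros)
    fix j
    show "(\<lambda>n. \<phi> (unit_vec (j + n))) \<longlonglongrightarrow> 0"
      using LIMSEQ_ignore_initial_segment[OF dual_unit_vec_tendsto_zero[OF \<phi>], of j]
      by (simp add: add.commute)
  qed
  then have "(\<lambda>n. \<Sum>j<K. x j * \<phi> (unit_vec (j + n))) \<longlonglongrightarrow> 0"
    by simp
  from LIMSEQ_D[OF this half_gt_zero[OF e]]
  obtain N where N: "\<And>n. n \<ge> N \<Longrightarrow> cmod ((\<Sum>j<K. x j * \<phi> (unit_vec (j + n))) - 0) < e / 2"
    by blast
  have "cmod (\<phi> (\<lambda>k. x (swap n k)) - 0) < e" if "n \<ge> max N K" for n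
  proof -
    have "cmod (\<phi> (\<lambda>k. x (swap n k))) \<le>
        cmod (\<Sum>j<K. x j * \<phi> (unit_vec (j + n))) + cmod (\<phi> (\<lambda>k. r (swap n k)))"
      using that by (simp add: split norm_triangle_ineq)
    then show ?thesis
      using N[of n] rest[of n] that by simp
  qed
  then show "\<exists>N. \<forall>n\<ge>N. cmod (\<phi> (\<lambda>k. x (swap n k)) - 0) < e"
    by blast
qed

text \<open>Only the scalar part survives weakly. Coefficients \<open>0\<close>, \<open>1\<close>
  give the generators, and \<open>2 / 3\<close>, \<open>1 / 3\<close> their resolvents at 2.\<close>

lemma pair_op_swap_weakly_converges:
  assumes x: "x \<in> carrier c0"
  shows "weakly_converges c0 (\<lambda>n. pair_op (swap n) a b x) (a \<odot>\<^bsub>c0\<^esub> x)"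
proof (subst c0.weakly_converges_iff, safe)
  fix \<phi> assume \<phi>: "\<phi> \<in> dual_space c0"
  have "\<phi> (pair_op (swap n) a b x) = a * \<phi> x + b * \<phi> (\<lambda>k. x (swap n k))" for n
  proof -
    have "pair_op (swap n) a b x = a \<odot>\<^bsub>c0\<^esub> x \<oplus>\<^bsub>c0\<^esub> b \<odot>\<^bsub>c0\<^esub> (\<lambda>k. x (swap n k))"
      by (simp add: pair_op_def c0_add c0_smult)
    then show ?thesis
      using x comp_closed[OF filterlim_swap x] \<phi> by (simp add: dual_add dual_smult)
  qed
  moreover have "(\<lambda>n. a * \<phi> x + b * \<phi> (\<lambda>k. x (swap n k))) \<longlonglongrightarrow> a * \<phi> x + b * 0"
    by (intro tendsto_intros swap_weak_tendsto_zero \<phi> x)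
  ultimately show "(\<lambda>n. \<phi> (pair_op (swap n) a b x)) \<longlonglongrightarrow> \<phi> (a \<odot>\<^bsub>c0\<^esub> x)"
    using \<phi> x by (simp add: dual_smult)
qed (use x in \<open>auto simp: pair_op_closed filterlim_swap\<close>)

section \<open>The semigroups of the counterexamples\<close>

definition swap_semigroup :: "nat \<Rightarrow> real \<Rightarrow> (nat \<Rightarrow> complex) \<Rightarrow> nat \<Rightarrow> complex" where
  "swap_semigroup n t = pair_op (swap n) (complex_of_real (cosh t)) (complex_of_real (sinh t))"

text \<open>Multiplication by \<open>exp (\<alpha> * t)\<close>, written as a pair operator for the
  identity permutation with \<open>s = 0\<close>, so that the general results on pair operators
  apply.\<close>

definition scalar_semigroup :: "real \<Rightarrow> real \<Rightarrow> (nat \<Rightarrow> complex) \<Rightarrow> nat \<Rightarrow> complex" where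
  "scalar_semigroup \<alpha> t = pair_op id (complex_of_real (exp (\<alpha> * t))) (complex_of_real 0)"

lemma C0_semigroup_swap: "C0_semigroup c0 (swap_semigroup n)"
  and opdom_swap: "opdom (generator c0 (swap_semigroup n)) = carrier c0"
  and opfun_swap: "x \<in> carrier c0 \<Longrightarrow>
    opfun (generator c0 (swap_semigroup n)) x = pair_op (swap n) 0 1 x"
proof -
  have d: "(cosh has_real_derivative 0) (at 0)" "(sinh has_real_derivative 1) (at (0::real))"
    by (auto intro!: derivative_eq_intros)
  have c: "continuous_on UNIV (cosh :: real \<Rightarrow> real)" "continuous_on UNIV (sinh :: real \<Rightarrow> real)"
    by (auto intro!: continuous_intros)
  note * = filterlim_swap swap_swap cosh_0 sinh_0 cosh_add sinh_add c d
  show "C0_semigroup c0 (swap_semigroup n)"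
    unfolding swap_semigroup_def[abs_def] by (rule C0_semigroup_pair_op[OF *])
  show "opdom (generator c0 (swap_semigroup n)) = carrier c0"
    unfolding swap_semigroup_def[abs_def] by (rule opdom_generator_pair_op[OF *])
  show "opfun (generator c0 (swap_semigroup n)) x = pair_op (swap n) 0 1 x" if "x \<in> carrier c0"
    using opfun_generator_pair_op[OF * that] by (simp add: swap_semigroup_def[abs_def])
qed

lemma C0_semigroup_scalar: "C0_semigroup c0 (scalar_semigroup \<alpha>)"
  and opdom_scalar: "opdom (generator c0 (scalar_semigroup \<alpha>)) = carrier c0"
  and opfun_scalar: "x \<in> carrier c0 \<Longrightarrow>
    opfun (generator c0 (scalar_semigroup \<alpha>)) x = complex_of_real \<alpha> \<odot>\<^bsub>c0\<^esub> x"
proof -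
  have d: "((\<lambda>t. exp (\<alpha> * t)) has_real_derivative \<alpha>) (at 0)" "((\<lambda>t. 0) has_real_derivative 0) (at (0::real))"
    by (auto intro!: derivative_eq_intros)
  have c: "continuous_on UNIV (\<lambda>t. exp (\<alpha> * t))" "continuous_on UNIV (\<lambda>t::real. 0::real)"
    by (auto intro!: continuous_intros)
  \<comment> \<open>The initial values and addition theorems for
    \<open>c t = exp (\<alpha> * t)\<close> and \<open>s t = 0\<close>; the trivial equations stand
    for the conditions on \<open>s\<close>.\<close>
  have e: "exp (\<alpha> * 0) = 1" "(0::real) = 0"
      "exp (\<alpha> * (u + v)) = exp (\<alpha> * u) * exp (\<alpha> * v) + 0 * 0"
      "(0::real) = 0 * exp (\<alpha> * v) + exp (\<alpha> * u) * 0" for u v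
    by (simp_all add: distrib_left exp_add)
  have i: "filterlim id sequentially sequentially" "id (id k) = k" for k :: nat
    by (simp_all add: id_def filterlim_ident)
  note * = i e c d
  show "C0_semigroup c0 (scalar_semigroup \<alpha>)"
    unfolding scalar_semigroup_def[abs_def] by (rule C0_semigroup_pair_op[OF *])
  show "opdom (generator c0 (scalar_semigroup \<alpha>)) = carrier c0"
    unfolding scalar_semigroup_def[abs_def] by (rule opdom_generator_pair_op[OF *])
  show "opfun (generator c0 (scalar_semigroup \<alpha>)) x = complex_of_real \<alpha> \<odot>\<^bsub>c0\<^esub> x"
    if "x \<in> carrier c0"
  proof -
    have "pair_op id (complex_of_real \<alpha>) (complex_of_real 0) x = complex_of_real \<alpha> \<odot>\<^bsub>c0\<^esub> x"
      by (simp add: pair_op_def c0_smult)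
    then show ?thesis
      unfolding scalar_semigroup_def[abs_def] using opfun_generator_pair_op[OF * that] by (simp only:)
  qed
qed

text \<open>The constants come from \<open>cosh t + sinh t = exp t\<close>, which bounds the norm of
  the swap semigroup; the scalar one fits under the same bound if \<open>\<alpha> \<le> 1\<close>.
  The generator is everywhere defined, so the whole space is a core.\<close>

lemma standing_assumptions_swap:
  assumes "\<alpha> \<le> 1"
  shows "standing_assumptions c0 (scalar_semigroup \<alpha>) swap_semigroup 1 1 (carrier c0)"
  unfolding standing_assumptions_def
proof (intro conjI allI impI c0.complex_banach_space_axioms C0_semigroup_scalar C0_semigroup_swap)
  fix t :: real and n assume t: "0 \<le> t"
  have "operator_norm c0 (scalar_semigroup \<alpha> t) \<le> exp (\<alpha> * t)"
    using operator_norm_pair_op_le[of id "complex_of_real (exp (\<alpha> * t))" 0]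
    by (simp add: scalar_semigroup_def id_def filterlim_ident)
  also have "\<dots> \<le> exp t"
    using mult_right_mono[OF assms t] by simp
  finally show "operator_norm c0 (scalar_semigroup \<alpha> t) \<le> 1 * exp (1 * t)"
    by simp
  have "operator_norm c0 (swap_semigroup n t) \<le> \<bar>cosh t\<bar> + \<bar>sinh t\<bar>"
    using operator_norm_pair_op_le[OF filterlim_swap, of n "complex_of_real (cosh t)" "complex_of_real (sinh t)"]
    by (simp only: swap_semigroup_def norm_of_real)
  also have "\<dots> = exp t"
    using t by (simp add: cosh_plus_sinh)
  finally show "operator_norm c0 (swap_semigroup n t) \<le> 1 * exp (1 * t)"
    by simp
next
  have "submodule (carrier c0) complex_field c0"
    by (rule c0.carrier_is_submodule)
  \<comment> \<open>Each vector approximates itself, and the difference is the zero vector.\<close>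
  moreover have "graph_norm c0 (generator c0 (scalar_semigroup \<alpha>)) \<zero>\<^bsub>c0\<^esub> = 0"
    by (simp add: graph_norm_def opfun_scalar)
  ultimately show "core_for c0 (carrier c0) (generator c0 (scalar_semigroup \<alpha>))"
    by (auto simp: core_for_def opdom_scalar intro!: bexI)
qed auto

lemma everywhere_bounded_swap: "everywhere_bounded c0 (generator c0 (swap_semigroup n))"
  unfolding everywhere_bounded_def
  using opdom_swap bounded_operator_cong[OF bounded_operator_pair_op[OF filterlim_swap] opfun_swap]
  by (auto simp: c0_add_closed c0_smult_closed)

text \<open>The generators are the swaps themselves; their weak limit 0 generates the constant
  semigroup.\<close>

lemma core_weak_convergence_swap:
  "core_weak_convergence c0 (generator c0 (scalar_semigroup 0))
     (\<lambda>n. generator c0 (swap_semigroup n)) (carrier c0)"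
  using pair_op_swap_weakly_converges[of _ 0 1]
  by (simp add: core_weak_convergence_def opdom_swap opfun_swap opfun_scalar)

text \<open>\<open>U\<^sub>n\<^sup>2 = I\<close> gives \<open>R(2, U\<^sub>n) = (2 + U\<^sub>n) / 3\<close>, which tends weakly to
  \<open>2 / 3 = R(2, I / 2)\<close>. At a single point \<open>z\<close> the weak limit of resolvents may well be the
  resolvent of an operator unrelated to the semigroups.\<close>

lemma resolvent_weak_convergence_swap:
  "resolvent_weak_convergence c0 (generator c0 (scalar_semigroup (1 / 2)))
     (\<lambda>n. generator c0 (swap_semigroup n)) 1"
proof -
  note st = standing_assumptionsD[OF standing_assumptions_swap[of "1 / 2", simplified]]
  have z: "Re 2 > 1"
    by simp
  let ?A = "generator c0 (scalar_semigroup (1 / 2))" and ?An = "\<lambda>n. generator c0 (swap_semigroup n)"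
  have "weakly_converges c0 (\<lambda>n. resolvent c0 2 (?An n) x) (resolvent c0 2 ?A x)"
    if x: "x \<in> carrier c0" for x
  proof -
    let ?y = "(2 / 3) \<odot>\<^bsub>c0\<^esub> x" and ?yn = "\<lambda>n. pair_op (swap n) (2 / 3) (1 / 3) x"
    have y: "?y \<in> carrier c0" "?yn n \<in> carrier c0" for n
      using x by (auto simp: pair_op_closed filterlim_swap)
    have "2 \<odot>\<^bsub>c0\<^esub> ?y \<ominus>\<^bsub>c0\<^esub> opfun ?A ?y = x"
      using y by (simp add: opfun_scalar c0_minus c0.vsmult_closed) (simp add: c0_smult)
    moreover have "resolvent c0 2 ?A (2 \<odot>\<^bsub>c0\<^esub> ?y \<ominus>\<^bsub>c0\<^esub> opfun ?A ?y) = ?y"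
      by (rule c0.resolvent_generator[OF st(2,4,5) z]) (use y in \<open>auto simp: opdom_scalar\<close>)
    moreover have "2 \<odot>\<^bsub>c0\<^esub> ?yn n \<ominus>\<^bsub>c0\<^esub> opfun (?An n) (?yn n) = x" for n
      using y by (simp add: opfun_swap c0_minus c0.vsmult_closed pair_op_closed filterlim_swap)
        (simp add: c0_smult pair_op_def algebra_simps)
    moreover have "resolvent c0 2 (?An n) (2 \<odot>\<^bsub>c0\<^esub> ?yn n \<ominus>\<^bsub>c0\<^esub> opfun (?An n) (?yn n)) = ?yn n" for n
      by (rule c0.resolvent_generator[OF st(3,4,6) z]) (use y in \<open>auto simp: opdom_swap\<close>)
    ultimately show ?thesis
      using pair_op_swap_weakly_converges[OF x, of "2 / 3" "1 / 3"] by simp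
  qed
  then show ?thesis
    unfolding resolvent_weak_convergence_def
    using z c0.in_resolvent_set[OF st(2,4,5) z] c0.in_resolvent_set[OF st(3,4,6) z]
    by (intro exI[of _ 2] conjI allI ballI)
qed

text \<open>Coordinate 0 of the orbit of the first unit vector is \<open>cosh t\<close> for every
  \<open>n \<ge> 1\<close>, so its distance from \<open>exp (\<alpha> * t)\<close> does not shrink
  with \<open>n\<close>. The range of \<open>\<alpha>\<close> covers both limits in use,
  \<open>0\<close> and \<open>1 / 2\<close>.\<close>

lemma not_semigroup_weak_convergence_swap:
  assumes "\<alpha> \<le> 1 / 2"
  shows "\<not> semigroup_weak_convergence c0 (scalar_semigroup \<alpha>) swap_semigroup"
proof
  assume conv: "semigroup_weak_convergence c0 (scalar_semigroup \<alpha>) swap_semigroup"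
  let ?\<phi> = "\<lambda>x::nat \<Rightarrow> complex. x 0" and ?x = "unit_vec 0"
  define \<Delta> where "\<Delta> n t = cmod (?\<phi> (swap_semigroup n t ?x \<ominus>\<^bsub>c0\<^esub> scalar_semigroup \<alpha> t ?x))" for n t
  have "?\<phi> \<in> dual_space c0"
    using c0_coord_le by (auto simp: dual_space_def c0_add c0_smult intro!: exI[of _ 1])
  then have lim: "(\<lambda>n. SUP t\<in>{0..2}. \<Delta> n t) \<longlonglongrightarrow> 0"
    using conv[unfolded semigroup_weak_convergence_def, rule_format, OF unit_vec_closed, of ?\<phi> 2]
    by (simp add: \<Delta>_def)
  \<comment> \<open>\<open>swap 0\<close> is the identity; from \<open>n = 1\<close> on the swap
    moves coordinate 0, and the \<open>sinh\<close> term vanishes there.\<close>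
  have \<Delta>: "\<Delta> n t = \<bar>cosh t - exp (\<alpha> * t)\<bar>" if "t \<ge> 0" "n \<ge> 1" for n t
  proof -
    have "\<Delta> n t = cmod (complex_of_real (cosh t) - complex_of_real (exp (\<alpha> * t)))"
      using that unit_vec_closed C0_semigroup_closed[OF C0_semigroup_swap]
        C0_semigroup_closed[OF C0_semigroup_scalar]
      by (simp add: \<Delta>_def c0_minus)
        (simp add: swap_semigroup_def scalar_semigroup_def pair_op_def unit_vec_def swap_def)
    then show ?thesis
      by (simp only: norm_of_real flip: of_real_diff)
  qed
  define d where "d = cosh 2 - exp (\<alpha> * 2)"
  have "exp (\<alpha> * 2) \<le> exp 1"
    using assms by simp
  \<comment> \<open>Time 2 separates the functions even at \<open>\<alpha> = 1 / 2\<close>: from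
    \<open>exp 1 > 2\<close> follows \<open>exp 2 > 2 * exp 1\<close>, and \<open>2 * cosh 2\<close>
    is larger still.\<close>
  moreover have "cosh 2 > exp (1::real)"
  proof -
    have "exp 1 > (2::real)"
      using exp_lower_Taylor_quadratic[of "1::real"] by simp
    then have "exp 1 * exp 1 > 2 * exp (1::real)"
      by (intro mult_strict_right_mono) auto
    then have "exp 2 > 2 * exp (1::real)"
      by (simp flip: exp_add)
    moreover have "2 * cosh 2 > exp (2::real)"
      by (simp add: cosh_def)
    ultimately show ?thesis
      by linarith
  qed
  ultimately have d: "d > 0"
    unfolding d_def by linarith
  have "d \<le> (SUP t\<in>{0..2}. \<Delta> n t)" if n: "n \<ge> 1" for n
  proof -
    \<comment> \<open>Continuity on a compact interval keeps the supremum finite, so it dominates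
      the value at time 2.\<close>
    have "compact ((\<lambda>t. \<bar>cosh t - exp (\<alpha> * t)\<bar>) ` {0..2})"
      by (intro compact_continuous_image continuous_intros) auto
    moreover have "\<Delta> n ` {0..2} = (\<lambda>t. \<bar>cosh t - exp (\<alpha> * t)\<bar>) ` {0..2}"
      using \<Delta> n by (intro image_cong) auto
    ultimately have "bdd_above (\<Delta> n ` {0..2})"
      by (simp add: compact_imp_bounded bounded_imp_bdd_above)
    then have "\<Delta> n 2 \<le> (SUP t\<in>{0..2}. \<Delta> n t)"
      by (intro cSUP_upper) auto
    then show ?thesis
      using \<Delta>[of 2 n] n by (simp add: d_def)
  qed
  then have "d \<le> 0"
    by (intro LIMSEQ_le_const[OF lim]) auto
  with d show False
    by simp
qed

theorem theorem2p4:
  shows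
   "(\<forall>(X :: 'a normed_module) T Tn M \<omega> D.
       standing_assumptions X T Tn M \<omega> D \<longrightarrow>
         (semigroup_weak_convergence X T Tn \<longrightarrow>
            resolvent_weak_convergence X (generator X T) (\<lambda>n. generator X (Tn n)) \<omega>) \<and>
         (resolvent_weak_convergence X (generator X T) (\<lambda>n. generator X (Tn n)) \<omega> \<longrightarrow>
            graph_weak_convergence X (generator X T) (\<lambda>n. generator X (Tn n)) D) \<and>
         (core_weak_convergence X (generator X T) (\<lambda>n. generator X (Tn n)) D \<longrightarrow>
            graph_weak_convergence X (generator X T) (\<lambda>n. generator X (Tn n)) D)) \<and>
    (\<exists>(X :: (nat \<Rightarrow> complex) normed_module) T Tn M \<omega> D.
       standing_assumptions X T Tn M \<omega> D \<and>
       (\<forall>n. everywhere_bounded X (generator X (Tn n))) \<and>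
       core_weak_convergence X (generator X T) (\<lambda>n. generator X (Tn n)) D \<and>
       \<not> semigroup_weak_convergence X T Tn) \<and>
    (\<exists>(X :: (nat \<Rightarrow> complex) normed_module) T Tn M \<omega> D.
       standing_assumptions X T Tn M \<omega> D \<and>
       (\<forall>n. everywhere_bounded X (generator X (Tn n))) \<and>
       graph_weak_convergence X (generator X T) (\<lambda>n. generator X (Tn n)) D \<and>
       \<not> semigroup_weak_convergence X T Tn) \<and>
    (\<exists>(X :: (nat \<Rightarrow> complex) normed_module) T Tn M \<omega> D.
       standing_assumptions X T Tn M \<omega> D \<and>
       (\<forall>n. everywhere_bounded X (generator X (Tn n))) \<and>
       resolvent_weak_convergence X (generator X T) (\<lambda>n. generator X (Tn n)) \<omega> \<and>
       \<not> semigroup_weak_convergence X T Tn)"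
proof (intro conjI)
  let ?D = "carrier c0"
  note swap = standing_assumptions_swap not_semigroup_weak_convergence_swap
  show "\<exists>(X :: (nat \<Rightarrow> complex) normed_module) T Tn M \<omega> D.
      standing_assumptions X T Tn M \<omega> D \<and>
      (\<forall>n. everywhere_bounded X (generator X (Tn n))) \<and>
      core_weak_convergence X (generator X T) (\<lambda>n. generator X (Tn n)) D \<and>
      \<not> semigroup_weak_convergence X T Tn"
    using core_weak_convergence_swap everywhere_bounded_swap swap[of 0]
    by (intro exI[of _ c0] exI[of _ "scalar_semigroup 0"] exI[of _ swap_semigroup] exI[of _ 1]
        exI[of _ ?D]) simp
  show "\<exists>(X :: (nat \<Rightarrow> complex) normed_module) T Tn M \<omega> D.
      standing_assumptions X T Tn M \<omega> D \<and>
      (\<forall>n. everywhere_bounded X (generator X (Tn n))) \<and>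
      graph_weak_convergence X (generator X T) (\<lambda>n. generator X (Tn n)) D \<and>
      \<not> semigroup_weak_convergence X T Tn"
    \<comment> \<open>The data that satisfy (a) satisfy (b) by the implication between them.\<close>
    using core_imp_graph_weak_convergence[OF standing_assumptions_swap core_weak_convergence_swap]
      everywhere_bounded_swap swap[of 0]
    by (intro exI[of _ c0] exI[of _ "scalar_semigroup 0"] exI[of _ swap_semigroup] exI[of _ 1]
        exI[of _ ?D]) simp
  show "\<exists>(X :: (nat \<Rightarrow> complex) normed_module) T Tn M \<omega> D.
      standing_assumptions X T Tn M \<omega> D \<and>
      (\<forall>n. everywhere_bounded X (generator X (Tn n))) \<and>
      resolvent_weak_convergence X (generator X T) (\<lambda>n. generator X (Tn n)) \<omega> \<and>
      \<not> semigroup_weak_convergence X T Tn"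
    using resolvent_weak_convergence_swap everywhere_bounded_swap swap[of "1 / 2"]
    by (intro exI[of _ c0] exI[of _ "scalar_semigroup (1 / 2)"] exI[of _ swap_semigroup] exI[of _ 1]
        exI[of _ ?D]) simp
qed (intro allI impI conjI; fact semigroup_imp_resolvent_weak_convergence
    resolvent_imp_graph_weak_convergence core_imp_graph_weak_convergence)

end
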